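(* Let $\mathsf{GR}=\mathsf{GR}(p^e,d)$, $A\in\mathsf{GR}^{t\times r}$, $B\in\mathsf{GR}^{r\times s}$, let $N$ be the number of worker nodes, $m=\lceil\log_p(N)/d\rceil$, and let $n=\Theta(m)$ be a divisor of $r$. Let $u,v,w$ be divisors of $t$, $s$ and $\frac rn$, respectively, such that $R:=uvw+w-1\le N$. Then the scheme $\widetilde{\mathsf{EP}}_{\mathsf{RMFE}}$-I (defined in the context) computes $AB$ with recovery threshold $R$. Moreover, its communication complexities, counted in elements of $\mathsf{GR}$, are - upload: $O\left(\frac{trv+sru}{uvw}\,N\right)$; - download: $O\left(\frac{ts}{uv}\,mR\right)$; and its computational costs, counted in operations in $\mathsf{GR}$, are - encoding: $\tilde O\left(\frac{trv+sru}{uvw}\,N\log^2N\right)$; - decoding: $\tilde O\left(\frac{ts}{uv}\,mR\log^2R\right)$; - computation of each worker node: $\tilde O\left(\frac{tsr}{uvw}\right)$.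
   Context: **Galois rings.** For a prime $p$ and integers $e,d\ge1$, $\mathsf{GR}(p^e,d)=\mathbb{Z}_{p^e}[x]/(f(x))$, where $f$ is monic of degree $d$ and irreducible modulo $p$. Write $\mathsf{GR}=\mathsf{GR}(p^e,d)$ and $\mathsf{GR}_k=\mathsf{GR}(p^e,dk)$, the extension of $\mathsf{GR}$ of degree $k$. An element of $\mathsf{GR}_k$ is represented by $k$ elements of $\mathsf{GR}$. A subset of a Galois ring is exceptional if the difference of any two distinct elements is invertible; $\mathsf{GR}_k$ has an exceptional set $T$ of size $p^{dk}$ (representatives modulo $p$). **RMFE.** An $(n,m)$-RMFE over $\mathsf{GR}$ is a pair $(\phi,\psi)$ of $\mathsf{GR}$-linear maps $\phi:\mathsf{GR}^n\to\mathsf{GR}_m$, $\psi:\mathsf{GR}_m\to\mathsf{GR}^n$ with $\psi(\phi(\mathbf x)\phi(\mathbf y))=\mathbf x\star\mathbf y$ for all $\mathbf x,\mathbf y\in\mathsf{GR}^n$, where $\star$ is the componentwise product. Standing assumption: an $(n,m)$-RMFE over $\mathsf{GR}$ is fixed such that each evaluation of $\phi$ or $\psi$ costs $O(m\log^2m\log\log m)$ operations in $\mathsf{GR}$. **Cost model and notation.** Costs are counted in operations in $\mathsf{GR}$ (computation) or elements of $\mathsf{GR}$ (communication). One arithmetic operation in $\mathsf{GR}_k$ costs $O(k\log^2k\log\log k)$ operations in $\mathsf{GR}$. Evaluating a polynomial of degree less than $\ell$ over a Galois ring at $\ell$ points of an exceptional set $T$, or interpolating such a polynomial from its values at those points, costs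 $O(\ell\log^2\ell\log\log\ell)$ operations in that ring. Worker nodes multiply an $a\times b$ by a $b\times c$ matrix using $O(abc)$ ring operations. $\tilde O$ omits factors polynomial in $\log\log N$. Here $p,e,d$ are fixed, and implied constants are independent of $t,r,s,u,v,w,n,N$ (they may depend on the constants in $n=\Theta(m)$). $N\ge2$, and $\log x$, $\log\log x$ inside $O$/$\tilde O$ are read as at least $1$. **Distributed model.** A master node encodes the inputs and sends data to each of $N$ worker nodes (upload is the total amount sent). Each worker computes a local product and returns it. The recovery threshold is $R$ if the responses of any $R$ workers suffice for the master to recover the desired output. Download is the total amount received from $R$ workers. Encoding (resp. decoding) complexity is the cost of the master's computation before sending (resp. after receiving). **EP codes over $\mathsf{GR}_m$.** Given $\mathcal A\in\mathsf{GR}_m^{t'\times r'}$, $\mathcal B\in\mathsf{GR}_m^{r'\times s'}$ and $u\mid t'$, $v\mid s'$, $w\mid r'$, partition $\mathcal A=(\mathcal A_{ij})_{1\le i\le u,1\le j\le w}$ with blocks of size $\frac{t'}u\times\frac{r'}w$ and $\mathcal B=(\mathcal B_{k\ell})_{1\le k\le w,1\le\ell\le v}$ with blocks of size $\frac{r'}w\times\frac{s'}v$. Set $f(x)=\sum_{i,j}\mathcal A_{ij}x^{(i-1)w+j-1}$, $g(x)=\sum_{k,\ell}\mathcal B_{k\ell}x^{w-k+(\ell-1)uw}$. For $N\le p^{dm}$ distinct points $\alpha_1,\dots,\alpha_N$ of an exceptional set of $\mathsf{GR}_m$, the master sends $f(\alpha_i),g(\alpha_i)$ to worker $i$, who returns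 $h(\alpha_i)=f(\alpha_i)g(\alpha_i)$. The master interpolates $h=fg$ from $R=uvw+w-1$ responses and reads the blocks $\sum_j\mathcal A_{ij}\mathcal B_{j\ell}$ of $\mathcal{AB}$ off the coefficients of $h$. **Batch-$\widetilde{\mathsf{EP}}_{\mathsf{RMFE}}$.** For batches $A_1,\dots,A_n\in\mathsf{GR}^{t'\times r'}$ and $B_1,\dots,B_n\in\mathsf{GR}^{r'\times s'}$: the master packs them into $\mathcal A,\mathcal B$ over $\mathsf{GR}_m$ by $\mathcal A[i,j]=\phi(A_1[i,j],\dots,A_n[i,j])$ and $\mathcal B[k,\ell]=\phi(B_1[k,\ell],\dots,B_n[k,\ell])$ (part of encoding), runs EP codes over $\mathsf{GR}_m$ with parameters $u,v,w$ and $N$ workers to obtain $\mathcal C=\mathcal{AB}$, and outputs $C_1,\dots,C_n$ given by $(C_1[i,\ell],\dots,C_n[i,\ell])=\psi(\mathcal C[i,\ell])$ (part of decoding), so that $C_i=A_iB_i$. **$\widetilde{\mathsf{EP}}_{\mathsf{RMFE}}$-I.** Partition $A=(A_1\ \cdots\ A_n)$ into column blocks $A_i\in\mathsf{GR}^{t\times\frac rn}$ and $B$ into row blocks $B_1,\dots,B_n\in\mathsf{GR}^{\frac rn\times s}$ (stacked vertically). Run Batch-$\widetilde{\mathsf{EP}}_{\mathsf{RMFE}}$ on $\{A_i\}_{i=1}^n$, $\{B_i\}_{i=1}^n$ with parameters $u,v,w$ to obtain $C_i=A_iB_i$, and output $\sum_{i=1}^nC_i=AB$ (the summation is part of decoding).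 *)

theory Defs
  imports
    Complex_Main
    "HOL-Algebra.UnivPoly"
    "HOL-Algebra.QuotRing"
    "HOL-Algebra.Ring_Divisibility"
    "HOL-Number_Theory.Residues"
    "Jordan_Normal_Form.Matrix"
begin

section \<open>Galois rings\<close>

definition zmod :: "nat \<Rightarrow> int ring" where
  "zmod q = residue_ring (int q)"

text \<open>A defining polynomial of \<open>GR(p^e,d)\<close>: monic of degree \<open>d\<close> over \<open>Z/p^e\<close>, with
  irreducible reduction modulo \<open>p\<close>. Univariate polynomials of \<^theory>\<open>HOL-Algebra.UnivPoly\<close> are
  their own coefficient functions, so the reduction acts directly on \<open>f\<close>.\<close>

definition galois_poly :: "nat \<Rightarrow> nat \<Rightarrow> nat \<Rightarrow> (nat \<Rightarrow> int) \<Rightarrow> bool" where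
  "galois_poly p e d f \<longleftrightarrow>
     f \<in> carrier (UP (zmod (p ^ e))) \<and>
     deg (zmod (p ^ e)) f = d \<and>
     up_ring.coeff (UP (zmod (p ^ e))) f d = \<one>\<^bsub>zmod (p ^ e)\<^esub> \<and>
     ring_irreducible\<^bsub>UP (zmod p)\<^esub> (\<lambda>i. up_ring.coeff (UP (zmod (p ^ e))) f i mod int p)"

definition galois_ring :: "nat \<Rightarrow> nat \<Rightarrow> (nat \<Rightarrow> int) \<Rightarrow> (nat \<Rightarrow> int) set ring" where
  "galois_ring p e f = UP (zmod (p ^ e)) Quot (PIdl\<^bsub>UP (zmod (p ^ e))\<^esub> f)"

definition exceptional :: "('a, 'c) ring_scheme \<Rightarrow> 'a set \<Rightarrow> bool" where
  "exceptional R T \<longleftrightarrow>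
     T \<subseteq> carrier R \<and> (\<forall>a\<in>T. \<forall>b\<in>T. a \<noteq> b \<longrightarrow> a \<ominus>\<^bsub>R\<^esub> b \<in> Units R)"

section \<open>Vectors and matrices over a ring given by its carrier\<close>

definition vecs :: "('a, 'c) ring_scheme \<Rightarrow> nat \<Rightarrow> 'a vec set" where
  "vecs R n = {x. dim_vec x = n \<and> (\<forall>i<n. x $ i \<in> carrier R)}"

definition vadd :: "('a, 'c) ring_scheme \<Rightarrow> 'a vec \<Rightarrow> 'a vec \<Rightarrow> 'a vec" where
  "vadd R x y = vec (dim_vec x) (\<lambda>i. x $ i \<oplus>\<^bsub>R\<^esub> y $ i)"

definition vscale :: "('a, 'c) ring_scheme \<Rightarrow> 'a \<Rightarrow> 'a vec \<Rightarrow> 'a vec" where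
  "vscale R c x = vec (dim_vec x) (\<lambda>i. c \<otimes>\<^bsub>R\<^esub> x $ i)"

definition vstar :: "('a, 'c) ring_scheme \<Rightarrow> 'a vec \<Rightarrow> 'a vec \<Rightarrow> 'a vec" where
  "vstar R x y = vec (dim_vec x) (\<lambda>i. x $ i \<otimes>\<^bsub>R\<^esub> y $ i)"

definition mats :: "('a, 'c) ring_scheme \<Rightarrow> nat \<Rightarrow> nat \<Rightarrow> 'a mat set" where
  "mats R nr nc = {M. dim_row M = nr \<and> dim_col M = nc \<and>
                     (\<forall>i<nr. \<forall>j<nc. M $$ (i, j) \<in> carrier R)}"

definition mmult :: "('a, 'c) ring_scheme \<Rightarrow> 'a mat \<Rightarrow> 'a mat \<Rightarrow> 'a mat" where
  "mmult R A B = mat (dim_row A) (dim_col B)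
     (\<lambda>(i, j). \<Oplus>\<^bsub>R\<^esub>k\<in>{..<dim_col A}. A $$ (i, k) \<otimes>\<^bsub>R\<^esub> B $$ (k, j))"

text \<open>Block \<open>(i,j)\<close>, counted from \<open>0\<close>, of \<open>M\<close> cut into \<open>nu\<close> by \<open>nw\<close> equal blocks.\<close>

definition block :: "'a mat \<Rightarrow> nat \<Rightarrow> nat \<Rightarrow> nat \<Rightarrow> nat \<Rightarrow> 'a mat" where
  "block M nu nw i j =
     (let h = dim_row M div nu; l = dim_col M div nw
      in mat h l (\<lambda>(a, b). M $$ (i * h + a, j * l + b)))"

section \<open>Reverse multiplication friendly embeddings\<close>

text \<open>\<open>S\<close> is regarded as an \<open>R\<close>-algebra through the ring homomorphism \<open>emb\<close>.\<close>

definition rmfe :: "('a, 'c) ring_scheme \<Rightarrow> ('b, 'd) ring_scheme \<Rightarrow> ('a \<Rightarrow> 'b) \<Rightarrow> nat \<Rightarrow>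
    ('a vec \<Rightarrow> 'b) \<Rightarrow> ('b \<Rightarrow> 'a vec) \<Rightarrow> bool" where
  "rmfe R S emb n \<phi> \<psi> \<longleftrightarrow>
     (\<forall>x\<in>vecs R n. \<phi> x \<in> carrier S) \<and>
     (\<forall>x\<in>vecs R n. \<forall>y\<in>vecs R n. \<phi> (vadd R x y) = \<phi> x \<oplus>\<^bsub>S\<^esub> \<phi> y) \<and>
     (\<forall>c\<in>carrier R. \<forall>x\<in>vecs R n. \<phi> (vscale R c x) = emb c \<otimes>\<^bsub>S\<^esub> \<phi> x) \<and>
     (\<forall>z\<in>carrier S. \<psi> z \<in> vecs R n) \<and>
     (\<forall>z\<in>carrier S. \<forall>z'\<in>carrier S. \<psi> (z \<oplus>\<^bsub>S\<^esub> z') = vadd R (\<psi> z) (\<psi> z')) \<and>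
     (\<forall>c\<in>carrier R. \<forall>z\<in>carrier S. \<psi> (emb c \<otimes>\<^bsub>S\<^esub> z) = vscale R c (\<psi> z)) \<and>
     (\<forall>x\<in>vecs R n. \<forall>y\<in>vecs R n. \<psi> (\<phi> x \<otimes>\<^bsub>S\<^esub> \<phi> y) = vstar R x y)"

section \<open>Cost model\<close>

definition lg :: "real \<Rightarrow> real" where
  "lg x = max 1 (ln x)"

definition lglg :: "real \<Rightarrow> real" where
  "lglg x = max 1 (ln (ln x))"

text \<open>\<open>ring_ops k\<close> is the cost, in operations of the base ring, of one arithmetic operation in its
  extension of degree \<open>k\<close>. The other three fields count operations of the ring in which the
  subroutine runs: multipoint evaluation and interpolation of polynomials of degree less than
  \<open>l\<close> at \<open>l\<close> points, and multiplication of an \<open>a\<close> by \<open>b\<close> with a \<open>b\<close> by \<open>c\<close> matrix.\<close>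

record cost_model =
  ring_ops :: "nat \<Rightarrow> nat"
  eval_ops :: "nat \<Rightarrow> nat"
  interp_ops :: "nat \<Rightarrow> nat"
  matmul_ops :: "nat \<Rightarrow> nat \<Rightarrow> nat \<Rightarrow> nat"

definition quasilinear :: "nat \<Rightarrow> real" where
  "quasilinear k = real k * (lg (real k))\<^sup>2 * lglg (real k)"

definition admissible :: "real \<Rightarrow> cost_model \<Rightarrow> bool" where
  "admissible K cm \<longleftrightarrow>
     (\<forall>k\<ge>1. real (ring_ops cm k) \<le> K * quasilinear k) \<and>
     (\<forall>l\<ge>1. real (eval_ops cm l) \<le> K * quasilinear l) \<and>
     (\<forall>l\<ge>1. real (interp_ops cm l) \<le> K * quasilinear l) \<and>
     (\<forall>a b c. real (matmul_ops cm a b c) \<le> K * (real a * real b * real c))"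

text \<open>A computation is represented by its result together with its number of operations in the
  base ring.\<close>

type_synonym 'x costed = "'x \<times> nat"

definition mat_costed :: "nat \<Rightarrow> nat \<Rightarrow> (nat \<times> nat \<Rightarrow> 'x costed) \<Rightarrow> 'x mat costed" where
  "mat_costed nr nc F =
     (mat nr nc (\<lambda>ij. fst (F ij)), \<Sum>i<nr. \<Sum>j<nc. snd (F (i, j)))"

text \<open>Polynomial subroutines in an extension \<open>S\<close> of degree \<open>k\<close>. The size charged for evaluation
  exceeds the degree of the polynomial even when there are fewer points.\<close>

definition multi_eval :: "cost_model \<Rightarrow> nat \<Rightarrow> 'b ring \<Rightarrow> (nat \<Rightarrow> 'b) \<Rightarrow> 'b list \<Rightarrow> 'b list costed"
  where
  "multi_eval cm k S q xs =
     (map (\<lambda>x. UnivPoly.eval S S id x q) xs,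
      eval_ops cm (max (Suc (deg S q)) (length xs)) * ring_ops cm k)"

definition interpolate :: "cost_model \<Rightarrow> nat \<Rightarrow> 'b ring \<Rightarrow> ('b \<times> 'b) list \<Rightarrow> (nat \<Rightarrow> 'b) costed"
  where
  "interpolate cm k S xys =
     (THE q. q \<in> carrier (UP S) \<and> deg S q < length xys \<and>
             (\<forall>(x, y)\<in>set xys. UnivPoly.eval S S id x q = y),
      interp_ops cm (length xys) * ring_ops cm k)"

text \<open>Number of base ring elements needed to transmit a matrix over an extension of degree \<open>k\<close>.\<close>

definition mat_size :: "nat \<Rightarrow> 'b mat \<Rightarrow> nat" where
  "mat_size k M = dim_row M * dim_col M * k"

section \<open>Schemes with a master node and worker nodes\<close>

text \<open>Workers are numbered from \<open>0\<close>; \<open>ws\<close> lists \<open>R\<close> different workers.\<close>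

definition responders :: "nat \<Rightarrow> nat \<Rightarrow> nat list \<Rightarrow> bool" where
  "responders N R ws \<longleftrightarrow> distinct ws \<and> length ws = R \<and> set ws \<subseteq> {..<N}"

text \<open>The decoder sees nothing but the labelled responses of the workers in \<open>ws\<close>.\<close>

definition collect :: "(nat \<Rightarrow> 'r) \<Rightarrow> nat list \<Rightarrow> (nat \<times> 'r) list" where
  "collect response ws = map (\<lambda>i. (i, response i)) ws"

definition recovery_threshold ::
  "nat \<Rightarrow> nat \<Rightarrow> (nat \<Rightarrow> 'r) \<Rightarrow> ((nat \<times> 'r) list \<Rightarrow> 'o) \<Rightarrow> 'o \<Rightarrow> bool" where
  "recovery_threshold N R response decode result \<longleftrightarrow>
     (\<forall>ws. responders N R ws \<longrightarrow> decode (collect response ws) = result)"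

text \<open>The data of a scheme: the base ring, its extension of degree \<open>ext_deg\<close>, an RMFE packing
  \<open>batch\<close> elements together with the costs of evaluating its two maps, the evaluation points of
  the workers, and the partition parameters \<open>u\<close>, \<open>v\<close>, \<open>w\<close>.\<close>

record ('a, 'b) scheme =
  base_ring :: "'a ring"
  ext_ring :: "'b ring"
  ext_deg :: nat
  batch :: nat
  rmfe_phi :: "'a vec \<Rightarrow> 'b"
  rmfe_psi :: "'b \<Rightarrow> 'a vec"
  phi_ops :: nat
  psi_ops :: nat
  points :: "'b list"
  par_u :: nat
  par_v :: nat
  par_w :: nat

subsection \<open>EP codes over the extension ring\<close>

text \<open>Entry \<open>(a,b)\<close> of the matrix polynomials
  \<open>f = \<Sum> A\<^sub>i\<^sub>j x^((i-1)w+j-1)\<close> and \<open>g = \<Sum> B\<^sub>k\<^sub>l x^(w-k+(l-1)uw)\<close>,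
  with all block indices shifted to start at \<open>0\<close>.\<close>

definition ep_f :: "('a, 'b) scheme \<Rightarrow> 'b mat \<Rightarrow> nat \<Rightarrow> nat \<Rightarrow> nat \<Rightarrow> 'b" where
  "ep_f s \<A> a b =
     (\<Oplus>\<^bsub>UP (ext_ring s)\<^esub>i\<in>{..<par_u s}. \<Oplus>\<^bsub>UP (ext_ring s)\<^esub>j\<in>{..<par_w s}.
        up_ring.monom (UP (ext_ring s))
          (block \<A> (par_u s) (par_w s) i j $$ (a, b)) (i * par_w s + j))"

definition ep_g :: "('a, 'b) scheme \<Rightarrow> 'b mat \<Rightarrow> nat \<Rightarrow> nat \<Rightarrow> nat \<Rightarrow> 'b" where
  "ep_g s \<B> a b =
     (\<Oplus>\<^bsub>UP (ext_ring s)\<^esub>k\<in>{..<par_w s}. \<Oplus>\<^bsub>UP (ext_ring s)\<^esub>l\<in>{..<par_v s}.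
        up_ring.monom (UP (ext_ring s))
          (block \<B> (par_w s) (par_v s) k l $$ (a, b))
          (par_w s - 1 - k + l * (par_u s * par_w s)))"

text \<open>The \<open>i\<close>-th component of the resulting list is the pair \<open>(f(\<alpha>\<^sub>i), g(\<alpha>\<^sub>i))\<close> sent to
  worker \<open>i\<close>.\<close>

definition ep_encode ::
  "cost_model \<Rightarrow> ('a, 'b) scheme \<Rightarrow> 'b mat \<Rightarrow> 'b mat \<Rightarrow> ('b mat \<times> 'b mat) list costed" where
  "ep_encode cm s \<A> \<B> =
     (let (FA, cA) = mat_costed (dim_row \<A> div par_u s) (dim_col \<A> div par_w s)
            (\<lambda>(a, b). multi_eval cm (ext_deg s) (ext_ring s) (ep_f s \<A> a b) (points s));
          (GB, cB) = mat_costed (dim_row \<B> div par_w s) (dim_col \<B> div par_v s)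
            (\<lambda>(a, b). multi_eval cm (ext_deg s) (ext_ring s) (ep_g s \<B> a b) (points s))
      in (map (\<lambda>i. (map_mat (\<lambda>ys. ys ! i) FA, map_mat (\<lambda>ys. ys ! i) GB)) [0..<length (points s)],
          cA + cB))"

definition worker :: "cost_model \<Rightarrow> ('a, 'b) scheme \<Rightarrow> 'b mat \<times> 'b mat \<Rightarrow> 'b mat costed" where
  "worker cm s = (\<lambda>(X, Y).
     (mmult (ext_ring s) X Y,
      matmul_ops cm (dim_row X) (dim_col X) (dim_col Y) * ring_ops cm (ext_deg s)))"

text \<open>Every entry of \<open>h = fg\<close> is interpolated; block \<open>(i,l)\<close> of the product (counted from \<open>0\<close>) is
  the coefficient of \<open>h\<close> at \<open>x^(iw + (w-1) + luw)\<close>.\<close>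

definition ep_decode ::
  "cost_model \<Rightarrow> ('a, 'b) scheme \<Rightarrow> nat \<Rightarrow> nat \<Rightarrow> (nat \<times> 'b mat) list \<Rightarrow> 'b mat costed" where
  "ep_decode cm s nr nc resp =
     (let hr = nr div par_u s; hc = nc div par_v s;
          (H, cH) = mat_costed hr hc
            (\<lambda>ab. interpolate cm (ext_deg s) (ext_ring s)
                    (map (\<lambda>(i, M). (points s ! i, M $$ ab)) resp))
      in (mat nr nc (\<lambda>(x, y). up_ring.coeff (UP (ext_ring s)) (H $$ (x mod hr, y mod hc))
            ((x div hr) * par_w s + (par_w s - 1) + (y div hc) * (par_u s * par_w s))),
          cH))"

subsection \<open>The batch scheme\<close>

definition pack ::
  "('a, 'b) scheme \<Rightarrow> nat \<Rightarrow> nat \<Rightarrow> 'a mat list \<Rightarrow> 'b mat costed" where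
  "pack s nr nc Ms =
     mat_costed nr nc (\<lambda>ij. (rmfe_phi s (vec (batch s) (\<lambda>l. (Ms ! l) $$ ij)), phi_ops s))"

text \<open>The matrices in \<open>As\<close> are \<open>nt\<close> by \<open>nr\<close>, those in \<open>Bs\<close> are \<open>nr\<close> by \<open>ns\<close>.\<close>

definition batch_encode ::
  "cost_model \<Rightarrow> ('a, 'b) scheme \<Rightarrow> nat \<Rightarrow> nat \<Rightarrow> nat \<Rightarrow> 'a mat list \<Rightarrow> 'a mat list \<Rightarrow>
     ('b mat \<times> 'b mat) list costed" where
  "batch_encode cm s nt nr ns As Bs =
     (let (\<A>, cA) = pack s nt nr As;
          (\<B>, cB) = pack s nr ns Bs;
          (shares, cE) = ep_encode cm s \<A> \<B>
      in (shares, cA + cB + cE))"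

definition batch_decode ::
  "cost_model \<Rightarrow> ('a, 'b) scheme \<Rightarrow> nat \<Rightarrow> nat \<Rightarrow> (nat \<times> 'b mat) list \<Rightarrow> 'a mat list costed" where
  "batch_decode cm s nt ns resp =
     (let (\<C>, cE) = ep_decode cm s nt ns resp;
          (V, cV) = mat_costed nt ns (\<lambda>ij. (rmfe_psi s (\<C> $$ ij), psi_ops s))
      in (map (\<lambda>l. map_mat (\<lambda>z. z $ l) V) [0..<batch s], cE + cV))"

subsection \<open>The scheme for a single product\<close>

definition schemeI_encode ::
  "cost_model \<Rightarrow> ('a, 'b) scheme \<Rightarrow> 'a mat \<Rightarrow> 'a mat \<Rightarrow> ('b mat \<times> 'b mat) list costed" where
  "schemeI_encode cm s A B =
     batch_encode cm s (dim_row A) (dim_col A div batch s) (dim_col B)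
       (map (\<lambda>l. block A 1 (batch s) 0 l) [0..<batch s])
       (map (\<lambda>l. block B (batch s) 1 l 0) [0..<batch s])"

text \<open>Adding up \<open>n\<close> matrices takes \<open>n - 1\<close> additions per entry.\<close>

definition schemeI_decode ::
  "cost_model \<Rightarrow> ('a, 'b) scheme \<Rightarrow> nat \<Rightarrow> nat \<Rightarrow> (nat \<times> 'b mat) list \<Rightarrow> 'a mat costed" where
  "schemeI_decode cm s nt ns resp =
     (let (Cs, cB) = batch_decode cm s nt ns resp;
          (C, cS) = mat_costed nt ns
            (\<lambda>ij. (\<Oplus>\<^bsub>base_ring s\<^esub>l\<in>{..<batch s}. (Cs ! l) $$ ij, batch s - 1))
      in (C, cB + cS))"

definition schemeI_response ::
  "cost_model \<Rightarrow> ('a, 'b) scheme \<Rightarrow> 'a mat \<Rightarrow> 'a mat \<Rightarrow> nat \<Rightarrow> 'b mat costed" where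
  "schemeI_response cm s A B i = worker cm s (fst (schemeI_encode cm s A B) ! i)"

definition schemeI_upload ::
  "cost_model \<Rightarrow> ('a, 'b) scheme \<Rightarrow> 'a mat \<Rightarrow> 'a mat \<Rightarrow> nat" where
  "schemeI_upload cm s A B =
     (\<Sum>(X, Y)\<leftarrow>fst (schemeI_encode cm s A B). mat_size (ext_deg s) X + mat_size (ext_deg s) Y)"

definition schemeI_download ::
  "cost_model \<Rightarrow> ('a, 'b) scheme \<Rightarrow> 'a mat \<Rightarrow> 'a mat \<Rightarrow> nat list \<Rightarrow> nat" where
  "schemeI_download cm s A B ws =
     (\<Sum>i\<leftarrow>ws. mat_size (ext_deg s) (fst (schemeI_response cm s A B i)))"

end

theory Submission
  imports Defs
begin

text \<open>
  The product exponents of an entangled polynomial code are arranged so that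
  \<open>(i' w + j) + (w - 1 - k + l' u w) = i w + (w - 1) + l u w\<close> forces \<open>i' = i\<close>, \<open>j = k\<close>, \<open>l' = l\<close>;
  hence the coefficient of \<open>h = f g\<close> at that exponent is a block of the product matrix. As \<open>h\<close> has
  degree at most \<open>R - 1\<close>, and a polynomial over a commutative ring with more roots in an
  exceptional set than its degree vanishes (split off linear factors and cancel the units
  \<open>x - a\<close>), any \<open>R\<close> responses determine \<open>h\<close>. Linearity of \<open>\<psi>\<close> and
  \<open>\<psi> (\<phi> x \<cdot> \<phi> y) = x \<star> y\<close> turn the packed product into the block products, whose sum is \<open>A B\<close>.

  For the costs, \<open>m\<close> is at most logarithmic in \<open>N\<close>, so \<open>log m = O(log log N)\<close> and one operation in
  \<open>GR\<^sub>m\<close> costs \<open>O(m (log log N)\<^sup>3)\<close>; the factor \<open>m\<close> cancels against the \<open>n = \<Theta>(m)\<close> products packed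
  together, and \<open>N \<ge> R \<ge> u v w\<close> absorbs the cost of packing and unpacking.
\<close>

section \<open>Polynomials over commutative rings\<close>

text \<open>Division with remainder by \<open>m\<close> numbers the pairs \<open>(j, k)\<close> in
  row-major order; the induction peels off the last row. It reassembles an inner product from its
  blocks, once for the \<open>w\<close> blocks of the code and once for the \<open>n\<close> blocks
  of the batch.\<close>

lemma (in abelian_monoid) finsum_blocks:
  fixes n m :: nat
  assumes "f \<in> {..<n * m} \<rightarrow> carrier G"
  shows "(\<Oplus>i\<in>{..<n * m}. f i) = (\<Oplus>j\<in>{..<n}. \<Oplus>k\<in>{..<m}. f (j * m + k))"
  using assms
proof (induction n)
  case 0
  then show ?case by simp
next
  case (Suc n)
  have split: "{..<Suc n * m} = {..<n * m} \<union> (\<lambda>k. n * m + k) ` {..<m}"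
  proof -
    have "x \<in> (\<lambda>k. n * m + k) ` {..<m}" if "x < m + n * m" "\<not> x < n * m" for x
      using that by (intro image_eqI[of _ _ "x - n * m"]) auto
    then show ?thesis by (auto simp: algebra_simps)
  qed
  have f: "f \<in> {..<n * m} \<rightarrow> carrier G" "f \<in> (\<lambda>k. n * m + k) ` {..<m} \<rightarrow> carrier G"
    using Suc.prems unfolding split by auto
  have row: "j * m + k < Suc n * m" if "j < Suc n" "k < m" for j k
  proof -
    have "j * m + k < Suc j * m"
      using that by simp
    also have "\<dots> \<le> Suc n * m"
      using that by (intro mult_le_mono1) simp
    finally show ?thesis .
  qed
  have "(\<Oplus>i\<in>{..<Suc n * m}. f i)
      = (\<Oplus>i\<in>{..<n * m}. f i) \<oplus> (\<Oplus>i\<in>(\<lambda>k. n * m + k) ` {..<m}. f i)"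
    unfolding split by (rule finsum_Un_disjoint) (use f in auto)
  also have "\<dots> = (\<Oplus>j\<in>{..<n}. \<Oplus>k\<in>{..<m}. f (j * m + k)) \<oplus> (\<Oplus>k\<in>{..<m}. f (n * m + k))"
    using Suc.IH[OF f(1)] add.finprod_reindex[OF f(2)] by simp
  also have "\<dots> = (\<Oplus>j\<in>{..<Suc n}. \<Oplus>k\<in>{..<m}. f (j * m + k))"
  proof -
    have "(\<Oplus>k\<in>{..<m}. f (j * m + k)) \<in> carrier G" if "j < Suc n" for j
      using Suc.prems row[OF that] by (intro finsum_closed) auto
    then show ?thesis
      unfolding lessThan_Suc by (subst finsum_insert) (auto simp: Pi_def a_comm)
  qed
  finally show ?case .
qed

lemma (in abelian_monoid) finsum_swap:
  assumes "finite I" "finite J" "\<And>i j. i \<in> I \<Longrightarrow> j \<in> J \<Longrightarrow> f i j \<in> carrier G"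
  shows "(\<Oplus>i\<in>I. \<Oplus>j\<in>J. f i j) = (\<Oplus>j\<in>J. \<Oplus>i\<in>I. f i j)"
  using assms(1,3)
proof (induction I)
  case empty
  then show ?case by simp
next
  case (insert x I)
  have "(\<Oplus>i\<in>insert x I. \<Oplus>j\<in>J. f i j) = (\<Oplus>j\<in>J. f x j) \<oplus> (\<Oplus>j\<in>J. \<Oplus>i\<in>I. f i j)"
    using insert by (subst finsum_insert) (auto simp: Pi_def intro!: finsum_closed)
  also have "\<dots> = (\<Oplus>j\<in>J. f x j \<oplus> (\<Oplus>i\<in>I. f i j))"
    using insert.prems by (intro finsum_addf[symmetric]) (auto intro!: finsum_closed)
  also have "\<dots> = (\<Oplus>j\<in>J. \<Oplus>i\<in>insert x I. f i j)"
    using insert by (intro finsum_cong') (auto intro!: finsum_closed)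
  finally show ?case .
qed

lemma (in abelian_monoid) finsum_delta:
  assumes "finite I" "a \<in> I" "f a \<in> carrier G"
  shows "(\<Oplus>i\<in>I. if i = a then f i else \<zero>) = f a"
proof -
  have "(\<Oplus>i\<in>I. if i = a then f i else \<zero>) = (\<Oplus>i\<in>I. if i = a then f a else \<zero>)"
    using assms by (intro finsum_cong') auto
  then show ?thesis
    using add.finprod_singleton_swap[OF assms(2,1), of "\<lambda>_. f a"] assms(3) by simp
qed

lemma (in abelian_monoid) finsum_delta2:
  assumes "finite I" "finite J" "a \<in> I" "b \<in> J" "f a b \<in> carrier G"
  shows "(\<Oplus>i\<in>I. \<Oplus>j\<in>J. if i = a \<and> j = b then f i j else \<zero>) = f a b"
proof -
  have "(\<Oplus>j\<in>J. if i = a \<and> j = b then f i j else \<zero>) = (if i = a then f a b else \<zero>)" for i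
  proof (cases "i = a")
    case True
    then show ?thesis
      using finsum_delta[of J b "f a"] assms by (simp only: True simp_thms if_True)
  qed simp
  then show ?thesis
    using finsum_delta[of I a "\<lambda>_. f a b"] assms by simp
qed

lemma (in UP_ring) coeff_finsum2:
  assumes "finite I" "finite J" "\<And>i j. i \<in> I \<Longrightarrow> j \<in> J \<Longrightarrow> f i j \<in> carrier P"
  shows "coeff P (\<Oplus>\<^bsub>P\<^esub>i\<in>I. \<Oplus>\<^bsub>P\<^esub>j\<in>J. f i j) n = (\<Oplus>i\<in>I. \<Oplus>j\<in>J. coeff P (f i j) n)"
proof -
  have "coeff P (\<Oplus>\<^bsub>P\<^esub>j\<in>J. f i j) n = (\<Oplus>j\<in>J. coeff P (f i j) n)" if "i \<in> I" for i
    using that assms by (intro coeff_finsum) auto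
  then show ?thesis
    using assms by (subst coeff_finsum) (auto intro!: P.finsum_closed R.finsum_closed R.finsum_cong')
qed

lemma (in UP_ring) deg_finsum_le:
  assumes "finite I" "\<And>i. i \<in> I \<Longrightarrow> q i \<in> carrier P" "\<And>i. i \<in> I \<Longrightarrow> deg R (q i) \<le> n"
  shows "deg R (\<Oplus>\<^bsub>P\<^esub>i\<in>I. q i) \<le> n"
proof (rule deg_aboveI)
  fix m assume "n < m"
  then have "coeff P (q i) m = \<zero>" if "i \<in> I" for i
    using assms(2,3)[OF that] by (intro deg_aboveD) auto
  then have "(\<Oplus>i\<in>I. coeff P (q i) m) = (\<Oplus>i\<in>I. \<zero>)"
    by (intro R.finsum_cong') auto
  then show "coeff P (\<Oplus>\<^bsub>P\<^esub>i\<in>I. q i) m = \<zero>"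
    using assms by (subst coeff_finsum) auto
qed (use assms in \<open>auto intro!: P.finsum_closed\<close>)

text \<open>Used at the degree of \<open>q\<close>: since \<open>X - a\<close> is monic, the leading
  coefficient of \<open>q\<close> survives one place higher, even when the ring has zero
  divisors.\<close>

lemma (in UP_cring) coeff_linear_mult_Suc:
  assumes "a \<in> carrier R" "q \<in> carrier P"
  shows "coeff P ((monom P \<one> 1 \<ominus>\<^bsub>P\<^esub> monom P a 0) \<otimes>\<^bsub>P\<^esub> q) (Suc k)
       = coeff P q k \<ominus> a \<otimes> coeff P q (Suc k)"
proof -
  have "(monom P \<one> 1 \<ominus>\<^bsub>P\<^esub> monom P a 0) \<otimes>\<^bsub>P\<^esub> q = (monom P \<one> 1 \<otimes>\<^bsub>P\<^esub> q) \<ominus>\<^bsub>P\<^esub> (monom P a 0 \<otimes>\<^bsub>P\<^esub> q)"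
    using assms by (simp add: P.minus_eq P.l_distr P.l_minus)
  moreover have "coeff P (monom P \<one> 1 \<otimes>\<^bsub>P\<^esub> q) (Suc k) = coeff P q k"
    using coeff_monom_mult[of \<one> q 1 k] assms by simp
  moreover have "coeff P (monom P a 0 \<otimes>\<^bsub>P\<^esub> q) (Suc k) = a \<otimes> coeff P q (Suc k)"
    using coeff_monom_mult[of a q 0 "Suc k"] assms by simp
  ultimately show ?thesis
    using assms by simp
qed

lemma (in UP_cring) eval_ring_hom_id:
  assumes "x \<in> carrier R"
  shows "ring_hom_cring P R (eval R R id x)"
proof -
  interpret UP_pre_univ_prop R R id P by standard simp
  show ?thesis
    using eval_ring_hom[OF assms] UP_cring R.is_cring by (intro ring_hom_cringI) auto
qed

text \<open>Induction on \<open>T\<close>. Dividing by \<open>X - a\<close> leaves the remainder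
  \<open>q(a) = 0\<close>, and at any other point \<open>x\<close> of \<open>T\<close> the factor
  \<open>x - a\<close> is a unit, so the quotient vanishes there too. Exceptionality replaces the
  integral domain property in the usual root count.\<close>

lemma (in UP_cring) zero_poly_of_exceptional_roots:
  assumes "exceptional R T" "finite T"
    and "q \<in> carrier P" "deg R q < card T" "\<And>x. x \<in> T \<Longrightarrow> eval R R id x q = \<zero>"
  shows "q = \<zero>\<^bsub>P\<^esub>"
proof (cases "carrier R = {\<zero>}")
  \<comment> \<open>The remainder theorem applied below asks for a nonzero ring; over the zero ring
    every coefficient is zero anyway.\<close>
  case True
  have "coeff P q k \<in> carrier R" for k
    using assms(3) by simp
  with True assms(3) show ?thesis
    by (intro up_eqI) auto
next
  case nontrivial: False
  show ?thesis
    using assms(2,1,3-)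
  proof (induction T arbitrary: q rule: finite_induct)
    case empty
    then show ?case by simp
  next
    case (insert a T)
    have T: "exceptional R T" and a: "a \<in> carrier R" and TR: "T \<subseteq> carrier R"
      and unit: "\<And>x. x \<in> T \<Longrightarrow> x \<ominus> a \<in> Units R"
      using insert.prems(1) insert.hyps by (auto simp: exceptional_def)
    let ?X = "monom P \<one> 1 \<ominus>\<^bsub>P\<^esub> monom P a 0"
    have X: "?X \<in> carrier P"
      using a by simp
    obtain q' r where q': "q' \<in> carrier P" and r: "r \<in> carrier P"
      and "q = ?X \<otimes>\<^bsub>P\<^esub> q' \<oplus>\<^bsub>P\<^esub> monom P (eval R R id a q) 0"
      using remainder_theorem[OF insert.prems(2) a nontrivial] by blast
    then have q: "q = ?X \<otimes>\<^bsub>P\<^esub> q'"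
      using insert.prems(4)[of a] X by simp
    have "eval R R id x q' = \<zero>" if "x \<in> T" for x
    proof -
      interpret ev: ring_hom_cring P R "eval R R id x"
        using that TR by (intro eval_ring_hom_id) auto
      interpret U: UP_pre_univ_prop R R id P by standard simp
      have x: "x \<in> carrier R" using that TR by auto
      have X_at: "eval R R id x ?X = x \<ominus> a"
      proof -
        have "eval R R id x ?X = eval R R id x (monom P \<one> 1) \<ominus> eval R R id x (monom P a 0)"
          using a by (simp add: P.minus_eq R.minus_eq)
        then show ?thesis
          using U.eval_monom1[OF x] U.eval_const[OF x a] by simp
      qed
      have "(x \<ominus> a) \<otimes> eval R R id x q' = \<zero>"
        using insert.prems(4)[of x] that ev.hom_mult[OF X q'] X_at unfolding q by (metis insertCI)
      then show ?thesis
        using unit[OF that] q' x a by (metis R.Units_l_cancel R.r_null R.zero_closed R.Units_closed ev.hom_closed)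
    qed
    \<comment> \<open>The bound is claimed for nonzero \<open>q'\<close> only: the zero polynomial
      has degree 0 by convention, which is not below \<open>card T\<close> when \<open>T\<close> is
      empty. This suffices, as the induction hypothesis would refute a nonzero
      \<open>q'\<close>.\<close>
    moreover have "deg R q' < card T" if "q' \<noteq> \<zero>\<^bsub>P\<^esub>"
    proof -
      have "coeff P q (Suc (deg R q')) = coeff P q' (deg R q')"
        using coeff_linear_mult_Suc[OF a q', of "deg R q'"] deg_aboveD[OF _ q', of "Suc (deg R q')"]
          q' a unfolding q by (simp add: R.minus_eq)
      also have "\<dots> \<noteq> \<zero>"
        using lcoeff_nonzero[OF that q'] .
      finally have "Suc (deg R q') \<le> deg R q"
        using insert.prems(2) by (intro deg_belowI) auto
      then show ?thesis
        using insert.prems(3) insert.hyps by simp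
    qed
    ultimately have "q' = \<zero>\<^bsub>P\<^esub>"
      using insert.IH[OF T q'] by blast
    then show ?case
      using X unfolding q by simp
  qed
qed

text \<open>The definite description in \<open>interpolate\<close> needs uniqueness: the difference
  of two candidates has degree below the number of points and vanishes at all of them.\<close>

lemma interpolate_eval:
  assumes "cring S" "exceptional S (set xs)" "distinct xs"
    and q: "q \<in> carrier (UP S)" "deg S q < length xs"
  shows "fst (interpolate cm k S (map (\<lambda>x. (x, UnivPoly.eval S S id x q)) xs)) = q"
proof -
  interpret S: cring S by fact
  interpret UP_cring S "UP S"
    by unfold_locales auto
  have "q' = q" if q': "q' \<in> carrier (UP S)" "deg S q' < length xs"
    and eq: "\<forall>x\<in>set xs. UnivPoly.eval S S id x q' = UnivPoly.eval S S id x q" for q'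
  proof -
    have "q' \<ominus>\<^bsub>UP S\<^esub> q = \<zero>\<^bsub>UP S\<^esub>"
    proof (rule zero_poly_of_exceptional_roots[OF assms(2)])
      show "deg S (q' \<ominus>\<^bsub>UP S\<^esub> q) < card (set xs)"
        using deg_add[of q' "\<ominus>\<^bsub>UP S\<^esub> q"] q q' distinct_card[OF assms(3)]
        by (simp add: P.minus_eq)
      show "UnivPoly.eval S S id x (q' \<ominus>\<^bsub>UP S\<^esub> q) = \<zero>\<^bsub>S\<^esub>" if "x \<in> set xs" for x
      proof -
        have "x \<in> carrier S"
          using that assms(2) by (auto simp: exceptional_def)
        then interpret ev: ring_hom_cring "UP S" S "UnivPoly.eval S S id x"
          by (rule eval_ring_hom_id)
        have "UnivPoly.eval S S id x (q' \<ominus>\<^bsub>UP S\<^esub> q)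
            = UnivPoly.eval S S id x q' \<ominus>\<^bsub>S\<^esub> UnivPoly.eval S S id x q"
          using ev.hom_add[OF q'(1) P.a_inv_closed[OF q(1)]] ev.hom_a_inv[OF q(1)]
          by (simp only: P.minus_eq S.minus_eq)
        also have "\<dots> = \<zero>\<^bsub>S\<^esub>"
          using bspec[OF eq that] ev.hom_closed[OF q(1)] by (simp only: S.minus_eq S.r_neg)
        finally show ?thesis .
      qed
    qed (use q q' in auto)
    then show ?thesis
      using q(1) q'(1) by (simp add: P.r_right_minus_eq)
  qed
  then show ?thesis
    unfolding interpolate_def fst_conv using q by (intro the_equality) auto
qed

text \<open>A quotient of a commutative polynomial ring by a principal ideal. The assumption on
  \<open>e\<close> makes the modulus exceed 1, as the locale of residue rings demands.\<close>

lemma cring_galois_ring: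
  assumes "prime p" "1 \<le> e" "galois_poly p e d f"
  shows "cring (galois_ring p e f)"
proof -
  have "1 < int (p ^ e)"
    using assms(1,2) prime_gt_1_nat[of p] by (metis not_one_le_zero of_nat_1 of_nat_less_iff one_less_power neq0_conv)
  then interpret Z: residues "int (p ^ e)" "zmod (p ^ e)"
    by unfold_locales (simp_all add: zmod_def)
  interpret UP_cring "zmod (p ^ e)" "UP (zmod (p ^ e))"
    by unfold_locales auto
  have "ideal (PIdl\<^bsub>UP (zmod (p ^ e))\<^esub> f) (UP (zmod (p ^ e)))"
    using assms(3) by (intro P.cgenideal_ideal) (simp add: galois_poly_def)
  then show ?thesis
    unfolding galois_ring_def by (rule ideal.quotient_is_cring) (rule UP_cring)
qed

section \<open>Entangled polynomial codes\<close>

text \<open>The two exponents differ by a multiple of \<open>w\<close> plus \<open>j - k\<close>,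
  and the latter is smaller than \<open>w\<close> in absolute value, so both parts vanish
  separately.\<close>

lemma ep_exponent_eq_iff:
  fixes u w :: nat
  assumes "i < u" "i' < u" "j < w" "k < w"
  shows "i' * w + j + (w - 1 - k + l' * (u * w)) = i * w + (w - 1) + l * (u * w)
     \<longleftrightarrow> i' = i \<and> k = j \<and> l' = l" (is "?L \<longleftrightarrow> ?R")
proof
  assume ?L
  \<comment> \<open>The integers avoid the truncated subtraction in
    \<open>w - 1 - k\<close>.\<close>
  then have "int i' * w + j + (int w - 1 - k + l' * (int u * w)) = int i * w + (int w - 1) + l * (int u * w)"
    using assms by (simp flip: of_nat_mult of_nat_add add: of_nat_diff)
  then have eq: "(int i' + int l' * u - (int i + int l * u)) * w = int k - int j"
    by (simp add: algebra_simps)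
  have "\<bar>int k - int j\<bar> < w"
    using assms by auto
  then have zero: "int i' + int l' * u - (int i + int l * u) = 0"
    using eq by (metis abs_mult abs_of_nat dvd_imp_le_int dvd_triv_right linorder_not_le mult_eq_0_iff zero_less_abs_iff)
  then have "k = j"
    using eq by simp
  moreover have "i' + l' * u = i + l * u"
    using zero by (simp flip: of_nat_mult of_nat_add)
  \<comment> \<open>Uniqueness of quotient and remainder modulo \<open>u\<close>, as
    \<open>i\<close> and \<open>i'\<close> are both below \<open>u\<close>.\<close>
  then have "i' = i" "l' = l"
    using assms by (metis mod_less mod_mult_self1, metis add.commute add_right_cancel assms(1,2) div_less div_mult_self3
        mod_less mod_mult_self1 not_less_zero add_0)
  ultimately show ?R by simp
qed (use assms in simp)

text \<open>Distributivity turns the product into a fourfold sum of monomials, one for each pair of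
  a term of the first factor and a term of the second. By the comparison of exponents only those
  with equal inner index and the prescribed outer indices contribute to this coefficient.\<close>

lemma (in UP_cring) coeff_ep_product:
  assumes A: "\<And>i j. i < u \<Longrightarrow> j < w \<Longrightarrow> A i j \<in> carrier R"
    and B: "\<And>k l. k < w \<Longrightarrow> l < v \<Longrightarrow> B k l \<in> carrier R"
    and i: "i < u" and l: "l < v"
  shows "coeff P
      ((\<Oplus>\<^bsub>P\<^esub>i\<in>{..<u}. \<Oplus>\<^bsub>P\<^esub>j\<in>{..<w}. monom P (A i j) (i * w + j)) \<otimes>\<^bsub>P\<^esub>
       (\<Oplus>\<^bsub>P\<^esub>k\<in>{..<w}. \<Oplus>\<^bsub>P\<^esub>l\<in>{..<v}. monom P (B k l) (w - 1 - k + l * (u * w))))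
      (i * w + (w - 1) + l * (u * w))
    = (\<Oplus>j\<in>{..<w}. A i j \<otimes> B j l)" (is "coeff P (?f \<otimes>\<^bsub>P\<^esub> ?g) ?e = _")
proof -
  let ?m = "\<lambda>i j k l. monom P (A i j \<otimes> B k l) (i * w + j + (w - 1 - k + l * (u * w)))"
  have row: "(\<Oplus>\<^bsub>P\<^esub>l\<in>{..<v}. monom P (B k l) (w - 1 - k + l * (u * w))) \<in> carrier P" if "k < w" for k
    using B that by (intro P.finsum_closed) auto
  have col: "(\<Oplus>\<^bsub>P\<^esub>j\<in>{..<w}. monom P (A i j) (i * w + j)) \<in> carrier P" if "i < u" for i
    using A that by (intro P.finsum_closed) auto
  have g: "?g \<in> carrier P"
    using row by (intro P.finsum_closed) auto
  have inner: "(\<Oplus>\<^bsub>P\<^esub>k\<in>{..<w}. \<Oplus>\<^bsub>P\<^esub>l\<in>{..<v}. ?m i j k l) = monom P (A i j) (i * w + j) \<otimes>\<^bsub>P\<^esub> ?g"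
    if "i < u" "j < w" for i j
  proof -
    have "monom P (A i j) (i * w + j) \<otimes>\<^bsub>P\<^esub> ?g = (\<Oplus>\<^bsub>P\<^esub>k\<in>{..<w}. monom P (A i j) (i * w + j) \<otimes>\<^bsub>P\<^esub>
       (\<Oplus>\<^bsub>P\<^esub>l\<in>{..<v}. monom P (B k l) (w - 1 - k + l * (u * w))))"
      using A that row by (intro P.finsum_rdistr) auto
    also have "\<dots> = (\<Oplus>\<^bsub>P\<^esub>k\<in>{..<w}. \<Oplus>\<^bsub>P\<^esub>l\<in>{..<v}. ?m i j k l)"
    proof (intro P.finsum_cong' refl)
      fix k assume k: "k \<in> {..<w}"
      have "monom P (A i j) (i * w + j) \<otimes>\<^bsub>P\<^esub> (\<Oplus>\<^bsub>P\<^esub>l\<in>{..<v}. monom P (B k l) (w - 1 - k + l * (u * w)))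
          = (\<Oplus>\<^bsub>P\<^esub>l\<in>{..<v}. monom P (A i j) (i * w + j) \<otimes>\<^bsub>P\<^esub> monom P (B k l) (w - 1 - k + l * (u * w)))"
        using A B that k by (intro P.finsum_rdistr) auto
      also have "\<dots> = (\<Oplus>\<^bsub>P\<^esub>l\<in>{..<v}. ?m i j k l)"
        using A B that k by (intro P.finsum_cong' refl monom_mult[symmetric]) auto
      finally show "monom P (A i j) (i * w + j) \<otimes>\<^bsub>P\<^esub>
          (\<Oplus>\<^bsub>P\<^esub>l\<in>{..<v}. monom P (B k l) (w - 1 - k + l * (u * w)))
          = (\<Oplus>\<^bsub>P\<^esub>l\<in>{..<v}. ?m i j k l)" .
    qed (use A B that in \<open>auto intro!: P.finsum_closed\<close>)
    finally show ?thesis by simp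
  qed
  have "?f \<otimes>\<^bsub>P\<^esub> ?g = (\<Oplus>\<^bsub>P\<^esub>i\<in>{..<u}. (\<Oplus>\<^bsub>P\<^esub>j\<in>{..<w}. monom P (A i j) (i * w + j)) \<otimes>\<^bsub>P\<^esub> ?g)"
    using g col by (intro P.finsum_ldistr) auto
  also have "\<dots> = (\<Oplus>\<^bsub>P\<^esub>i\<in>{..<u}. \<Oplus>\<^bsub>P\<^esub>j\<in>{..<w}. monom P (A i j) (i * w + j) \<otimes>\<^bsub>P\<^esub> ?g)"
    using g A by (intro P.finsum_cong' refl P.finsum_ldistr) (auto intro!: P.finsum_closed)
  also have "\<dots> = (\<Oplus>\<^bsub>P\<^esub>i\<in>{..<u}. \<Oplus>\<^bsub>P\<^esub>j\<in>{..<w}. \<Oplus>\<^bsub>P\<^esub>k\<in>{..<w}. \<Oplus>\<^bsub>P\<^esub>l\<in>{..<v}. ?m i j k l)"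
    using A B by (intro P.finsum_cong' refl inner[symmetric]) (auto intro!: P.finsum_closed)
  finally have prod: "?f \<otimes>\<^bsub>P\<^esub> ?g
    = (\<Oplus>\<^bsub>P\<^esub>i\<in>{..<u}. \<Oplus>\<^bsub>P\<^esub>j\<in>{..<w}. \<Oplus>\<^bsub>P\<^esub>k\<in>{..<w}. \<Oplus>\<^bsub>P\<^esub>l\<in>{..<v}. ?m i j k l)" .
  have "coeff P (\<Oplus>\<^bsub>P\<^esub>k\<in>{..<w}. \<Oplus>\<^bsub>P\<^esub>l\<in>{..<v}. ?m i' j k l) ?e
      = (if i' = i then A i j \<otimes> B j l else \<zero>)" if "i' < u" "j < w" for i' j
  proof -
    have "coeff P (\<Oplus>\<^bsub>P\<^esub>k\<in>{..<w}. \<Oplus>\<^bsub>P\<^esub>l\<in>{..<v}. ?m i' j k l) ?e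
        = (\<Oplus>k\<in>{..<w}. \<Oplus>l\<in>{..<v}. coeff P (?m i' j k l) ?e)"
      using A B that by (intro coeff_finsum2) auto
    \<comment> \<open>The conditions are nested so that the sums over \<open>k\<close> and
      \<open>l'\<close> collapse first and the condition on \<open>i'\<close> is left for the outer
      sum. Writing \<open>A i j\<close> for \<open>A i' j\<close> is harmless under that
      condition.\<close>
    also have "\<dots> = (\<Oplus>k\<in>{..<w}. \<Oplus>l'\<in>{..<v}. if k = j \<and> l' = l then
        (if i' = i then A i j \<otimes> B k l' else \<zero>) else \<zero>)"
    proof -
      have "coeff P (?m i' j k l') ?e
          = (if k = j \<and> l' = l then (if i' = i then A i j \<otimes> B k l' else \<zero>) else \<zero>)"
        if "k < w" "l' < v" for k l'
        using A B that i ep_exponent_eq_iff[OF i \<open>i' < u\<close> \<open>j < w\<close> \<open>k < w\<close>, of l' l] \<open>i' < u\<close> \<open>j < w\<close>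
        by auto
      then show ?thesis
        using A B i that
        by (intro R.finsum_cong' refl) (auto simp del: coeff_monom intro!: R.finsum_closed R.finsum_cong')
    qed
    also have "\<dots> = (if i' = i then A i j \<otimes> B j l else \<zero>)"
      using A B i l that by (subst R.finsum_delta2) auto
    finally show ?thesis .
  qed
  then have "coeff P (?f \<otimes>\<^bsub>P\<^esub> ?g) ?e = (\<Oplus>i'\<in>{..<u}. \<Oplus>j\<in>{..<w}. if i' = i then A i j \<otimes> B j l else \<zero>)"
    unfolding prod using A B i l
    by (subst coeff_finsum2) (auto intro!: P.finsum_closed R.finsum_closed R.finsum_cong')
  also have "\<dots> = (\<Oplus>i'\<in>{..<u}. if i' = i then (\<Oplus>j\<in>{..<w}. A i j \<otimes> B j l) else \<zero>)"
    using A B i l by (intro R.finsum_cong' refl) (auto intro!: R.finsum_closed)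
  also have "\<dots> = (\<Oplus>j\<in>{..<w}. A i j \<otimes> B j l)"
    using A B i l by (subst R.finsum_delta) (auto intro!: R.finsum_closed)
  finally show ?thesis .
qed

lemma fst_mat_costed: "fst (mat_costed nr nc F) = mat nr nc (\<lambda>ij. fst (F ij))"
  by (simp add: mat_costed_def)

lemma fst_ep_encode_nth:
  assumes "i < length (points sch)"
  shows "fst (ep_encode cm sch \<A> \<B>) ! i =
    (mat (dim_row \<A> div par_u sch) (dim_col \<A> div par_w sch)
       (\<lambda>(a, b). UnivPoly.eval (ext_ring sch) (ext_ring sch) id (points sch ! i) (ep_f sch \<A> a b)),
     mat (dim_row \<B> div par_w sch) (dim_col \<B> div par_v sch)
       (\<lambda>(a, b). UnivPoly.eval (ext_ring sch) (ext_ring sch) id (points sch ! i) (ep_g sch \<B> a b)))"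
  using assms
  by (auto simp: ep_encode_def split_beta fst_mat_costed multi_eval_def intro!: eq_matI)

lemma length_fst_ep_encode: "length (fst (ep_encode cm sch \<A> \<B>)) = length (points sch)"
  by (simp add: ep_encode_def split_beta)

lemma row_major_less:
  fixes i k n a :: nat
  assumes "i < n" "a < k"
  shows "i * k + a < n * k"
proof -
  have "i * k + a < Suc i * k"
    using assms by simp
  also have "\<dots> \<le> n * k"
    using assms by (intro mult_le_mono1) simp
  finally show ?thesis .
qed

lemma index_block:
  assumes "M \<in> mats S nr nc" "a < nr div nu" "b < nc div nw"
  shows "block M nu nw i j $$ (a, b) = M $$ (i * (nr div nu) + a, j * (nc div nw) + b)"
  using assms by (auto simp: block_def mats_def Let_def)

lemma block_closed:
  assumes "M \<in> mats S nr nc" "i < nu" "j < nw" "nu dvd nr" "nw dvd nc"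
    "a < nr div nu" "b < nc div nw"
  shows "block M nu nw i j $$ (a, b) \<in> carrier S"
proof -
  have "i * (nr div nu) + a < nr" "j * (nc div nw) + b < nc"
    using row_major_less[of i nu a "nr div nu"] row_major_less[of j nw b "nc div nw"] assms by auto
  then show ?thesis
    using assms by (auto simp: index_block[OF assms(1,6,7)] mats_def)
qed

lemma mmult_closed:
  assumes "cring S" "A \<in> mats S nt nr" "B \<in> mats S nr ns"
  shows "mmult S A B \<in> mats S nt ns"
proof -
  interpret cring S by fact
  show ?thesis
    using assms by (auto simp: mats_def mmult_def intro!: finsum_closed)
qed

text \<open>The degree bound serves twice: for unique interpolation from the responses, and for the
  size charged for multipoint evaluation.\<close>

lemma ep_f_closed:
  fixes sch :: "('a, 'b) scheme" and S :: "'b ring"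
  assumes "cring S" and sch: "ext_ring sch = S" "par_u sch = u" "par_w sch = w"
    and dvd: "u dvd t" "w dvd r" and \<A>: "\<A> \<in> mats S t r"
    and ak: "a < t div u" "k < r div w"
  shows "ep_f sch \<A> a k \<in> carrier (UP S)" "deg S (ep_f sch \<A> a k) \<le> u * w - 1"
proof -
  interpret S: cring S by fact
  interpret UP_cring S "UP S"
    by unfold_locales auto
  note closed = block_closed[OF \<A> _ _ dvd ak]
  show "ep_f sch \<A> a k \<in> carrier (UP S)"
    unfolding ep_f_def sch using closed by (auto intro!: P.finsum_closed)
  have "i * w + j \<le> u * w - 1" if "i < u" "j < w" for i j
    using row_major_less[OF that] by simp
  then show "deg S (ep_f sch \<A> a k) \<le> u * w - 1"
    unfolding ep_f_def sch using closed
    by (intro deg_finsum_le P.finsum_closed order_trans[OF deg_monom_le]) (auto intro!: P.finsum_closed)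
qed

lemma ep_g_closed:
  fixes sch :: "('a, 'b) scheme" and S :: "'b ring"
  assumes "cring S"
    and sch: "ext_ring sch = S" "par_u sch = u" "par_v sch = v" "par_w sch = w"
    and dvd: "w dvd r" "v dvd s" and \<B>: "\<B> \<in> mats S r s"
    and kb: "k < r div w" "b < s div v"
  shows "ep_g sch \<B> k b \<in> carrier (UP S)" "deg S (ep_g sch \<B> k b) \<le> w - 1 + (v - 1) * (u * w)"
proof -
  interpret S: cring S by fact
  interpret UP_cring S "UP S"
    by unfold_locales auto
  note closed = block_closed[OF \<B> _ _ dvd kb]
  show "ep_g sch \<B> k b \<in> carrier (UP S)"
    unfolding ep_g_def sch using closed by (auto intro!: P.finsum_closed)
  have "w - 1 - k' + l * (u * w) \<le> w - 1 + (v - 1) * (u * w)" if "l < v" for k' l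
    using that by (intro add_mono mult_le_mono1) auto
  then have "deg S (monom (UP S) (block \<B> w v k' l $$ (k, b)) (w - 1 - k' + l * (u * w)))
      \<le> w - 1 + (v - 1) * (u * w)" if "k' < w" "l < v" for k' l
    using that closed by (intro order_trans[OF deg_monom_le])
  then show "deg S (ep_g sch \<B> k b) \<le> w - 1 + (v - 1) * (u * w)"
    unfolding ep_g_def sch using closed
    by (intro deg_finsum_le P.finsum_closed) (auto intro!: P.finsum_closed simp del: One_nat_def)
qed

text \<open>The left side is exactly \<open>u * v * w + w - 2\<close>. Hence the degree of
  \<open>f * g\<close> is below the number of responses, and each factor alone has degree below it
  as well.\<close>

lemma ep_degree_sum:
  fixes u v w :: nat
  assumes "0 < u" "0 < v" "0 < w"
  shows "(u * w - 1) + (w - 1 + (v - 1) * (u * w)) < u * v * w + w - 1"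
proof -
  have "(v - 1) * (u * w) + u * w = u * v * w" "0 < u * w"
    using assms by (auto simp: algebra_simps diff_mult_distrib2)
  then show ?thesis
    using assms by linarith
qed

text \<open>Every response is the value at one point of a fixed matrix of polynomials whose degrees
  are below the number of responses. Interpolation therefore returns these polynomials whichever
  workers answer, and the coefficients read off are the entries of the product.\<close>

lemma ep_decode_correct:
  fixes sch :: "('a, 'b) scheme" and S :: "'b ring"
  assumes "cring S"
    and sch: "ext_ring sch = S" "par_u sch = u" "par_v sch = v" "par_w sch = w"
    and pos: "0 < u" "0 < v" "0 < w"
    and dvd: "u dvd t" "w dvd r" "v dvd s"
    and \<A>: "\<A> \<in> mats S t r" and \<B>: "\<B> \<in> mats S r s"
    and pts: "exceptional S (set (points sch))" "distinct (points sch)"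
    and ws: "responders (length (points sch)) (u * v * w + w - 1) ws"
  shows "fst (ep_decode cm sch t s
      (collect (\<lambda>i. fst (worker cm sch (fst (ep_encode cm sch \<A> \<B>) ! i))) ws)) = mmult S \<A> \<B>"
proof -
  interpret S: cring S by fact
  interpret UP_cring S "UP S"
    by unfold_locales auto
  let ?f = "ep_f sch \<A>" and ?g = "ep_g sch \<B>"
  let ?ht = "t div u" and ?hr = "r div w" and ?hs = "s div v"
  let ?pt = "\<lambda>i. points sch ! i"
  \<comment> \<open>Entry \<open>(a, b)\<close> of the matrix polynomial
    \<open>h = f g\<close>.\<close>
  define q where "q = (\<lambda>a b. \<Oplus>\<^bsub>UP S\<^esub>k\<in>{..<?hr}. ?f a k \<otimes>\<^bsub>UP S\<^esub> ?g k b)"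
  note closed = block_closed[OF \<A> _ _ dvd(1,2)] block_closed[OF \<B> _ _ dvd(2,3)]
    and f = ep_f_closed[OF assms(1) sch(1,2,4) dvd(1,2) \<A>] and g = ep_g_closed[OF assms(1) sch dvd(2,3) \<B>]
  have q: "q a b \<in> carrier (UP S)" "deg S (q a b) < u * v * w + w - 1" if "a < ?ht" "b < ?hs" for a b
  proof -
    show "q a b \<in> carrier (UP S)"
      unfolding q_def using that f g by (auto intro!: P.finsum_closed)
    have "deg S (?f a k \<otimes>\<^bsub>UP S\<^esub> ?g k b) \<le> (u * w - 1) + (w - 1 + (v - 1) * (u * w))" if "k < ?hr" for k
      using deg_mult_ring[OF f(1) g(1)] f(2) g(2) that \<open>a < ?ht\<close> \<open>b < ?hs\<close>
      by (meson add_mono order_trans)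
    then have "deg S (q a b) \<le> (u * w - 1) + (w - 1 + (v - 1) * (u * w))"
      unfolding q_def using that f g by (intro deg_finsum_le) auto
    also have "\<dots> < u * v * w + w - 1"
      using ep_degree_sum[OF pos] .
    finally show "deg S (q a b) < u * v * w + w - 1" .
  qed
  have response: "fst (worker cm sch (fst (ep_encode cm sch \<A> \<B>) ! i))
      = mat ?ht ?hs (\<lambda>(a, b). UnivPoly.eval S S id (?pt i) (q a b))" if "i < length (points sch)" for i
  proof -
    have x: "?pt i \<in> carrier S"
      using that pts(1) by (auto simp: exceptional_def)
    interpret ev: ring_hom_cring "UP S" S "UnivPoly.eval S S id (?pt i)"
      by (rule eval_ring_hom_id[OF x])
    have "UnivPoly.eval S S id (?pt i) (q a b)
        = (\<Oplus>\<^bsub>S\<^esub>k\<in>{..<?hr}. UnivPoly.eval S S id (?pt i) (?f a k) \<otimes>\<^bsub>S\<^esub> UnivPoly.eval S S id (?pt i) (?g k b))"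
      if "a < ?ht" "b < ?hs" for a b
    proof -
      have "UnivPoly.eval S S id (?pt i) (q a b)
          = (\<Oplus>\<^bsub>S\<^esub>k\<in>{..<?hr}. UnivPoly.eval S S id (?pt i) (?f a k \<otimes>\<^bsub>UP S\<^esub> ?g k b))"
        unfolding q_def using that f g by (subst ev.hom_finsum) (auto simp: comp_def)
      also have "\<dots> = (\<Oplus>\<^bsub>S\<^esub>k\<in>{..<?hr}.
          UnivPoly.eval S S id (?pt i) (?f a k) \<otimes>\<^bsub>S\<^esub> UnivPoly.eval S S id (?pt i) (?g k b))"
        using that by (intro S.finsum_cong' refl ev.hom_mult) (auto intro!: S.m_closed ev.hom_closed f g)
      finally show ?thesis .
    qed
    then show ?thesis
      using \<A> \<B>
      by (intro eq_matI)
        (auto simp: fst_ep_encode_nth[OF that] worker_def sch mmult_def mats_def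
          intro!: S.finsum_cong' S.m_closed ev.hom_closed f g)
  qed
  have ws': "set ws \<subseteq> {..<length (points sch)}" "distinct ws" "length ws = u * v * w + w - 1"
    using ws by (auto simp: responders_def)
  have interpolated: "fst (interpolate cm k S (map (\<lambda>(i, M). (?pt i, M $$ (a, b)))
      (collect (\<lambda>i. fst (worker cm sch (fst (ep_encode cm sch \<A> \<B>) ! i))) ws))) = q a b"
    if "a < ?ht" "b < ?hs" for a b k
  proof -
    have "map (\<lambda>(i, M). (?pt i, M $$ (a, b)))
        (collect (\<lambda>i. fst (worker cm sch (fst (ep_encode cm sch \<A> \<B>) ! i))) ws)
      = map (\<lambda>x. (x, UnivPoly.eval S S id x (q a b))) (map ?pt ws)"
      using ws'(1) response that by (auto simp: collect_def)
    \<comment> \<open>Different workers hold different points, and a subset of an exceptional set is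
      exceptional; uniqueness of the interpolant rests on both.\<close>
    moreover have "distinct (map ?pt ws)"
      using ws'(1,2) pts(2) by (auto simp: distinct_map intro!: inj_on_nth)
    moreover have "exceptional S (set (map ?pt ws))"
      using pts(1) ws'(1) nth_mem[of _ "points sch"] unfolding exceptional_def by (auto simp: subset_iff)
    ultimately show ?thesis
      using interpolate_eval[OF assms(1), of "map ?pt ws" "q a b"] q[OF that] ws'(3) by simp
  qed
  have coeff_q: "coeff (UP S) (q a b) (i * w + (w - 1) + l * (u * w))
      = (\<Oplus>\<^bsub>S\<^esub>z\<in>{..<r}. \<A> $$ (i * ?ht + a, z) \<otimes>\<^bsub>S\<^esub> \<B> $$ (z, l * ?hs + b))"
    if "a < ?ht" "b < ?hs" "i < u" "l < v" for a b i l
  proof -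
    let ?e = "i * w + (w - 1) + l * (u * w)"
    let ?h = "\<lambda>z. \<A> $$ (i * ?ht + a, z) \<otimes>\<^bsub>S\<^esub> \<B> $$ (z, l * ?hs + b)"
    have h: "?h z \<in> carrier S" if "z < r" for z
      using \<A> \<B> that row_major_less[OF \<open>i < u\<close> \<open>a < ?ht\<close>] row_major_less[OF \<open>l < v\<close> \<open>b < ?hs\<close>] dvd
      by (auto simp: mats_def)
    have r: "r = w * ?hr" "\<And>j k. j < w \<Longrightarrow> k < ?hr \<Longrightarrow> j * ?hr + k < r"
      using dvd row_major_less[of _ w _ ?hr] by auto
    have "coeff (UP S) (q a b) ?e = (\<Oplus>\<^bsub>S\<^esub>k\<in>{..<?hr}. coeff (UP S) (?f a k \<otimes>\<^bsub>UP S\<^esub> ?g k b) ?e)"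
      unfolding q_def using that f g by (intro coeff_finsum) auto
    \<comment> \<open>For a fixed position \<open>k\<close> inside the blocks, the coefficient sums
      over the block index \<open>j\<close>. After an exchange of the sums,
      \<open>z = j * (r div w) + k\<close> runs through the whole inner range.\<close>
    also have "\<dots> = (\<Oplus>\<^bsub>S\<^esub>k\<in>{..<?hr}. \<Oplus>\<^bsub>S\<^esub>j\<in>{..<w}. ?h (j * ?hr + k))"
    proof (intro S.finsum_cong' refl)
      fix k assume k: "k \<in> {..<?hr}"
      have "coeff (UP S) (?f a k \<otimes>\<^bsub>UP S\<^esub> ?g k b) ?e
          = (\<Oplus>\<^bsub>S\<^esub>j\<in>{..<w}. block \<A> u w i j $$ (a, k) \<otimes>\<^bsub>S\<^esub> block \<B> w v j l $$ (k, b))"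
        unfolding ep_f_def ep_g_def sch using that k closed by (intro coeff_ep_product) auto
      also have "\<dots> = (\<Oplus>\<^bsub>S\<^esub>j\<in>{..<w}. ?h (j * ?hr + k))"
        using that k h r by (intro S.finsum_cong' refl) (auto simp: index_block[OF \<A>] index_block[OF \<B>])
      finally show "coeff (UP S) (?f a k \<otimes>\<^bsub>UP S\<^esub> ?g k b) ?e = (\<Oplus>\<^bsub>S\<^esub>j\<in>{..<w}. ?h (j * ?hr + k))" .
    qed (use h r in \<open>auto intro!: S.finsum_closed\<close>)
    also have "\<dots> = (\<Oplus>\<^bsub>S\<^esub>j\<in>{..<w}. \<Oplus>\<^bsub>S\<^esub>k\<in>{..<?hr}. ?h (j * ?hr + k))"
      using h r by (intro S.finsum_swap) auto
    also have "\<dots> = (\<Oplus>\<^bsub>S\<^esub>z\<in>{..<w * ?hr}. ?h z)"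
      using h r by (intro S.finsum_blocks[symmetric]) auto
    finally show ?thesis
      using r(1) by simp
  qed
  show ?thesis
  proof (rule eq_matI)
    fix x y assume "x < dim_row (mmult S \<A> \<B>)" "y < dim_col (mmult S \<A> \<B>)"
    then have x: "x < t" and y: "y < s"
      using \<A> \<B> by (auto simp: mmult_def mats_def)
    \<comment> \<open>A row number splits into a block number and an offset. The block height is
      positive because a row \<open>x\<close> below \<open>t\<close> exists.\<close>
    have x': "x mod ?ht < ?ht" "x div ?ht < u" "x div ?ht * ?ht + x mod ?ht = x"
      using x dvd pos by (auto simp: less_mult_imp_div_less div_mult_mod_eq dvd_div_eq_0_iff
          intro!: mod_less_divisor less_mult_imp_div_less gr0I)
    have y': "y mod ?hs < ?hs" "y div ?hs < v" "y div ?hs * ?hs + y mod ?hs = y"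
      using y dvd pos by (auto simp: less_mult_imp_div_less div_mult_mod_eq dvd_div_eq_0_iff
          intro!: mod_less_divisor less_mult_imp_div_less gr0I)
    show "fst (ep_decode cm sch t s
        (collect (\<lambda>i. fst (worker cm sch (fst (ep_encode cm sch \<A> \<B>) ! i))) ws)) $$ (x, y)
      = mmult S \<A> \<B> $$ (x, y)"
      using x y x' y' \<A> \<B> interpolated[OF x'(1) y'(1)] coeff_q[OF x'(1) y'(1) x'(2) y'(2)]
      by (simp add: ep_decode_def Let_def split_beta fst_mat_costed sch mmult_def mats_def)
  qed (use \<A> \<B> in \<open>auto simp: ep_decode_def Let_def split_beta mmult_def mats_def\<close>)
qed

section \<open>Recovery of the product\<close>

text \<open>Induction from binary additivity, stated componentwise because the decoder adds up
  components of \<psi> in the base ring.\<close>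

lemma rmfe_psi_finsum:
  assumes "cring R" "cring S" and rmfe: "rmfe R S emb n \<phi> \<psi>"
    and "finite I" "\<And>i. i \<in> I \<Longrightarrow> z i \<in> carrier S" "l < n"
  shows "\<psi> (\<Oplus>\<^bsub>S\<^esub>i\<in>I. z i) $ l = (\<Oplus>\<^bsub>R\<^esub>i\<in>I. \<psi> (z i) $ l)"
proof -
  interpret R: cring R by fact
  interpret S: cring S by fact
  have vec: "dim_vec (\<psi> x) = n" "\<psi> x $ l \<in> carrier R" if "x \<in> carrier S" for x
    using rmfe that \<open>l < n\<close> by (auto simp: rmfe_def vecs_def)
  have add: "\<psi> (x \<oplus>\<^bsub>S\<^esub> y) $ l = \<psi> x $ l \<oplus>\<^bsub>R\<^esub> \<psi> y $ l" if "x \<in> carrier S" "y \<in> carrier S" for x y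
  proof -
    have "\<psi> (x \<oplus>\<^bsub>S\<^esub> y) = vadd R (\<psi> x) (\<psi> y)"
      using rmfe that unfolding rmfe_def by blast
    then show ?thesis
      using vec(1)[OF that(1)] \<open>l < n\<close> by (simp add: vadd_def)
  qed
  \<comment> \<open>From \<psi>(0) = \<psi>(0) + \<psi>(0) by cancellation.\<close>
  have zero: "\<psi> \<zero>\<^bsub>S\<^esub> $ l = \<zero>\<^bsub>R\<^esub>"
    using add[of "\<zero>\<^bsub>S\<^esub>" "\<zero>\<^bsub>S\<^esub>"] vec(2)[of "\<zero>\<^bsub>S\<^esub>"] by (simp add: R.add.l_cancel_one')
  show ?thesis
    using assms(4,5)
  proof (induction I)
    case empty
    then show ?case
      using zero by simp
  next
    case (insert a I)
    have "\<psi> (\<Oplus>\<^bsub>S\<^esub>i\<in>insert a I. z i) $ l = \<psi> (z a \<oplus>\<^bsub>S\<^esub> (\<Oplus>\<^bsub>S\<^esub>i\<in>I. z i)) $ l"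
      using insert by (subst S.finsum_insert) auto
    also have "\<dots> = \<psi> (z a) $ l \<oplus>\<^bsub>R\<^esub> (\<Oplus>\<^bsub>R\<^esub>i\<in>I. \<psi> (z i) $ l)"
      using insert by (subst add) (auto intro!: S.finsum_closed)
    also have "\<dots> = (\<Oplus>\<^bsub>R\<^esub>i\<in>insert a I. \<psi> (z i) $ l)"
      using insert vec(2) by (subst R.finsum_insert) auto
    finally show ?case .
  qed
qed

lemma rmfe_psi_mult:
  assumes "rmfe R S emb n \<phi> \<psi>" "x \<in> vecs R n" "y \<in> vecs R n" "l < n"
  shows "\<psi> (\<phi> x \<otimes>\<^bsub>S\<^esub> \<phi> y) $ l = x $ l \<otimes>\<^bsub>R\<^esub> y $ l"
proof -
  have "\<psi> (\<phi> x \<otimes>\<^bsub>S\<^esub> \<phi> y) = vstar R x y"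
    using assms unfolding rmfe_def by blast
  then show ?thesis
    using assms(2,4) by (simp add: vstar_def vecs_def)
qed

text \<open>The code returns the product of the packed matrices. Component \<open>l\<close> of
  \<psi> at an entry is the partial inner product over the \<open>l\<close>-th block of the inner
  range, and the final summation joins these blocks.\<close>

lemma schemeI_recovery:
  fixes sch :: "('a, 'b) scheme"
  assumes "cring R" "cring S"
    and sch: "base_ring sch = R" "ext_ring sch = S" "batch sch = n"
      "par_u sch = u" "par_v sch = v" "par_w sch = w"
    and rmfe: "rmfe R S emb n (rmfe_phi sch) (rmfe_psi sch)"
    and pos: "0 < u" "0 < v" "0 < w" "0 < n"
    and dvd: "u dvd t" "n dvd r" "w dvd r div n" "v dvd s"
    and A: "A \<in> mats R t r" and B: "B \<in> mats R r s"
    and pts: "exceptional S (set (points sch))" "distinct (points sch)"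
  shows "recovery_threshold (length (points sch)) (u * v * w + w - 1)
    (\<lambda>i. fst (schemeI_response cm sch A B i)) (\<lambda>resp. fst (schemeI_decode cm sch t s resp))
    (mmult R A B)"
  unfolding recovery_threshold_def
proof (intro allI impI)
  fix ws assume ws: "responders (length (points sch)) (u * v * w + w - 1) ws"
  interpret R: cring R by fact
  interpret S: cring S by fact
  let ?\<phi> = "rmfe_phi sch" and ?\<psi> = "rmfe_psi sch"
  let ?m = "r div n"
  define \<A> where "\<A> = fst (pack sch t ?m (map (\<lambda>l. block A 1 n 0 l) [0..<n]))"
  define \<B> where "\<B> = fst (pack sch ?m s (map (\<lambda>l. block B n 1 l 0) [0..<n]))"
  \<comment> \<open>The vectors packed into one entry: they collect the entries at the same position
    of all \<open>n\<close> blocks.\<close>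
  let ?a = "\<lambda>x k. vec n (\<lambda>l. A $$ (x, l * ?m + k))"
  let ?b = "\<lambda>k y. vec n (\<lambda>l. B $$ (l * ?m + k, y))"
  have row: "l * ?m + k < r" if "l < n" "k < ?m" for l k
    using row_major_less[OF that] dvd(2) by simp
  have \<A>_eq: "\<A> = mat t ?m (\<lambda>(x, k). ?\<phi> (?a x k))"
    using index_block[OF A, of _ 1 _ n] unfolding \<A>_def pack_def fst_mat_costed sch
    by (intro eq_matI) (auto intro!: arg_cong[where f = ?\<phi>] eq_vecI)
  have \<B>_eq: "\<B> = mat ?m s (\<lambda>(k, y). ?\<phi> (?b k y))"
    using index_block[OF B, of _ n _ 1] unfolding \<B>_def pack_def fst_mat_costed sch
    by (intro eq_matI) (auto intro!: arg_cong[where f = ?\<phi>] eq_vecI)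
  have a: "?a x k \<in> vecs R n" if "x < t" "k < ?m" for x k
    using A row that by (auto simp: vecs_def mats_def)
  have b: "?b k y \<in> vecs R n" if "y < s" "k < ?m" for k y
    using B row that by (auto simp: vecs_def mats_def)
  have \<phi>: "?\<phi> x \<in> carrier S" if "x \<in> vecs R n" for x
    using rmfe that by (auto simp: rmfe_def)
  have \<A>: "\<A> \<in> mats S t ?m" and \<B>: "\<B> \<in> mats S ?m s"
    using \<phi>[OF a] \<phi>[OF b] by (auto simp: \<A>_eq \<B>_eq mats_def)
  have shares: "fst (schemeI_encode cm sch A B) = fst (ep_encode cm sch \<A> \<B>)"
    using A B by (simp add: schemeI_encode_def batch_encode_def split_beta mats_def sch \<A>_def \<B>_def)
  have \<C>: "fst (ep_decode cm sch t s (collect (\<lambda>i. fst (schemeI_response cm sch A B i)) ws)) = mmult S \<A> \<B>"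
    unfolding schemeI_response_def shares
    using ep_decode_correct[OF assms(2) sch(2,4-6) pos(1-3) dvd(1,3,4) \<A> \<B> pts ws] .
  have entry: "(\<Oplus>\<^bsub>R\<^esub>l\<in>{..<n}. ?\<psi> (mmult S \<A> \<B> $$ (x, y)) $ l) = mmult R A B $$ (x, y)"
    if "x < t" "y < s" for x y
  proof -
    let ?h = "\<lambda>z. A $$ (x, z) \<otimes>\<^bsub>R\<^esub> B $$ (z, y)"
    have h: "?h z \<in> carrier R" if "z < r" for z
      using A B that \<open>x < t\<close> \<open>y < s\<close> by (auto simp: mats_def)
    have "mmult S \<A> \<B> $$ (x, y) = (\<Oplus>\<^bsub>S\<^esub>k\<in>{..<?m}. ?\<phi> (?a x k) \<otimes>\<^bsub>S\<^esub> ?\<phi> (?b k y))"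
      using that \<phi>[OF a] \<phi>[OF b] by (auto simp: mmult_def \<A>_eq \<B>_eq intro!: S.finsum_cong')
    moreover have "?\<psi> (\<Oplus>\<^bsub>S\<^esub>k\<in>{..<?m}. ?\<phi> (?a x k) \<otimes>\<^bsub>S\<^esub> ?\<phi> (?b k y)) $ l
        = (\<Oplus>\<^bsub>R\<^esub>k\<in>{..<?m}. ?\<psi> (?\<phi> (?a x k) \<otimes>\<^bsub>S\<^esub> ?\<phi> (?b k y)) $ l)" if "l < n" for l
      using that \<open>x < t\<close> \<open>y < s\<close> \<phi> a b by (intro rmfe_psi_finsum[OF assms(1,2) rmfe]) auto
    moreover have "?\<psi> (?\<phi> (?a x k) \<otimes>\<^bsub>S\<^esub> ?\<phi> (?b k y)) $ l = ?h (l * ?m + k)" if "l < n" "k < ?m" for l k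
      using that \<open>x < t\<close> \<open>y < s\<close> by (subst rmfe_psi_mult[OF rmfe a b]) auto
    ultimately have "?\<psi> (mmult S \<A> \<B> $$ (x, y)) $ l = (\<Oplus>\<^bsub>R\<^esub>k\<in>{..<?m}. ?h (l * ?m + k))" if "l < n" for l
      using that h row by (auto intro!: R.finsum_cong')
    then have "(\<Oplus>\<^bsub>R\<^esub>l\<in>{..<n}. ?\<psi> (mmult S \<A> \<B> $$ (x, y)) $ l)
        = (\<Oplus>\<^bsub>R\<^esub>l\<in>{..<n}. \<Oplus>\<^bsub>R\<^esub>k\<in>{..<?m}. ?h (l * ?m + k))"
      using h row by (intro R.finsum_cong') (auto intro!: R.finsum_closed)
    also have "\<dots> = (\<Oplus>\<^bsub>R\<^esub>z\<in>{..<n * ?m}. ?h z)"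
      using h dvd(2) by (intro R.finsum_blocks[symmetric]) auto
    also have "\<dots> = mmult R A B $$ (x, y)"
      using that A B dvd(2) by (simp add: mmult_def mats_def)
    finally show ?thesis .
  qed
  have "?\<psi> (mmult S \<A> \<B> $$ (x, y)) $ l \<in> carrier R" if "x < t" "y < s" "l < n" for x y l
    using mmult_closed[OF assms(2) \<A> \<B>] rmfe that by (auto simp: rmfe_def vecs_def mats_def)
  then have decoded: "fst (schemeI_decode cm sch t s (collect (\<lambda>i. fst (schemeI_response cm sch A B i)) ws)) $$ (x, y)
      = mmult R A B $$ (x, y)" if "x < t" "y < s" for x y
    using that by (simp add: schemeI_decode_def batch_decode_def split_beta fst_mat_costed sch \<C> flip: entry)
      (auto intro!: R.finsum_cong')
  then show "fst (schemeI_decode cm sch t s (collect (\<lambda>i. fst (schemeI_response cm sch A B i)) ws)) = mmult R A B"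
    using A B by (intro eq_matI)
      (auto simp: mmult_def mats_def schemeI_decode_def split_beta fst_mat_costed)
qed

section \<open>Costs\<close>

lemma snd_mat_costed_const:
  assumes "\<And>i j. i < nr \<Longrightarrow> j < nc \<Longrightarrow> snd (F (i, j)) = c"
  shows "snd (mat_costed nr nc F) = nr * nc * c"
proof -
  have "(\<Sum>i<nr. \<Sum>j<nc. snd (F (i, j))) = (\<Sum>i<nr. \<Sum>j<nc. c)"
    using assms by (intro sum.cong) auto
  then show ?thesis
    by (simp add: mat_costed_def mult.assoc)
qed

text \<open>One multipoint evaluation per entry of a block. All degrees lie below the recovery
  threshold, hence below the number of points, so the maximum in \<open>multi_eval\<close> is the
  number of points.\<close>

lemma ep_encode_cost:
  fixes sch :: "('a, 'b) scheme" and S :: "'b ring"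
  assumes "cring S"
    and sch: "ext_ring sch = S" "par_u sch = u" "par_v sch = v" "par_w sch = w"
    and pos: "0 < u" "0 < v" "0 < w"
    and dvd: "u dvd t" "w dvd r" "v dvd s"
    and \<A>: "\<A> \<in> mats S t r" and \<B>: "\<B> \<in> mats S r s"
    and N: "u * v * w + w - 1 \<le> length (points sch)"
  shows "snd (ep_encode cm sch \<A> \<B>) = ((t div u) * (r div w) + (r div w) * (s div v)) *
    (eval_ops cm (length (points sch)) * ring_ops cm (ext_deg sch))"
proof -
  have *: "max (Suc d) (length (points sch)) = length (points sch)"
    if "d \<le> u * w - 1 \<or> d \<le> w - 1 + (v - 1) * (u * w)" for d
    using that ep_degree_sum[OF pos] N by linarith
  have eval: "snd (multi_eval cm (ext_deg sch) S q (points sch))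
      = eval_ops cm (length (points sch)) * ring_ops cm (ext_deg sch)"
    if "deg S q \<le> u * w - 1 \<or> deg S q \<le> w - 1 + (v - 1) * (u * w)" for q
    by (simp add: multi_eval_def *[OF that])
  have "snd (mat_costed (t div u) (r div w)
        (\<lambda>(a, b). multi_eval cm (ext_deg sch) S (ep_f sch \<A> a b) (points sch)))
      = (t div u) * (r div w) * (eval_ops cm (length (points sch)) * ring_ops cm (ext_deg sch))"
    by (rule snd_mat_costed_const, unfold split_conv, rule eval)
      (use ep_f_closed(2)[OF assms(1) sch(1,2,4) dvd(1,2) \<A>] in blast)
  moreover have "snd (mat_costed (r div w) (s div v)
        (\<lambda>(a, b). multi_eval cm (ext_deg sch) S (ep_g sch \<B> a b) (points sch)))
      = (r div w) * (s div v) * (eval_ops cm (length (points sch)) * ring_ops cm (ext_deg sch))"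
    by (rule snd_mat_costed_const, unfold split_conv, rule eval)
      (use ep_g_closed(2)[OF assms(1) sch dvd(2,3) \<B>] in blast)
  ultimately show ?thesis
    using \<A> \<B> by (simp add: ep_encode_def split_beta sch mats_def add_mult_distrib)
qed

text \<open>The degree bounds behind the encoding cost presuppose that the packed matrices have
  entries in the extension ring.\<close>

lemma pack_closed:
  assumes rmfe: "rmfe R S emb n (rmfe_phi sch) (rmfe_psi sch)" and "batch sch = n"
    and "length Ms = n" "\<And>M. M \<in> set Ms \<Longrightarrow> M \<in> mats R nr nc"
  shows "fst (pack sch nr nc Ms) \<in> mats S nr nc"
proof -
  have "vec n (\<lambda>l. (Ms ! l) $$ (i, j)) \<in> vecs R n" if "i < nr" "j < nc" for i j
    using assms(3,4) that by (auto simp: vecs_def mats_def)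
  then show ?thesis
    using rmfe assms(2) by (auto simp: pack_def fst_mat_costed mats_def rmfe_def)
qed

lemma block_mats:
  assumes "M \<in> mats S nr nc" "i < nu" "j < nw" "nu dvd nr" "nw dvd nc"
  shows "block M nu nw i j \<in> mats S (nr div nu) (nc div nw)"
proof -
  have "dim_row (block M nu nw i j) = nr div nu" "dim_col (block M nu nw i j) = nc div nw"
    using assms(1) by (auto simp: block_def mats_def Let_def)
  then show ?thesis
    using block_closed[OF assms] by (simp add: mats_def)
qed

lemma snd_pack: "snd (pack sch nr nc Ms) = nr * nc * phi_ops sch"
  unfolding pack_def by (rule snd_mat_costed_const) simp

lemma schemeI_encode_cost:
  fixes sch :: "('a, 'b) scheme"
  assumes "cring S"
    and sch: "ext_ring sch = S" "batch sch = n" "par_u sch = u" "par_v sch = v" "par_w sch = w"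
    and rmfe: "rmfe R S emb n (rmfe_phi sch) (rmfe_psi sch)"
    and pos: "0 < u" "0 < v" "0 < w" "0 < n"
    and dvd: "u dvd t" "n dvd r" "w dvd r div n" "v dvd s"
    and A: "A \<in> mats R t r" and B: "B \<in> mats R r s"
    and N: "u * v * w + w - 1 \<le> length (points sch)"
  shows "snd (schemeI_encode cm sch A B) =
    (t * (r div n) + (r div n) * s) * phi_ops sch +
    ((t div u) * (r div n div w) + (r div n div w) * (s div v)) *
      (eval_ops cm (length (points sch)) * ring_ops cm (ext_deg sch))"
proof -
  have "block A 1 n 0 l \<in> mats R t (r div n)" "block B n 1 l 0 \<in> mats R (r div n) s" if "l < n" for l
    using block_mats[OF A, of 0 1 l n] block_mats[OF B, of l n 0 1] that dvd by auto
  then have "fst (pack sch t (r div n) (map (\<lambda>l. block A 1 n 0 l) [0..<n])) \<in> mats S t (r div n)"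
    "fst (pack sch (r div n) s (map (\<lambda>l. block B n 1 l 0) [0..<n])) \<in> mats S (r div n) s"
    by (auto intro!: pack_closed[OF rmfe sch(2)])
  from ep_encode_cost[OF assms(1) sch(1,3-5) pos(1-3) dvd(1,3,4) this N]
  show ?thesis
    using A B
    by (simp add: schemeI_encode_def batch_encode_def split_beta sch snd_pack mats_def add_mult_distrib)
qed

text \<open>Upload, download and worker cost depend on the shares only through these
  dimensions.\<close>

lemma schemeI_share_dims:
  fixes sch :: "('a, 'b) scheme" and cm :: cost_model
  assumes "i < length (points sch)" "A \<in> mats R t r" "B \<in> mats R r s" "batch sch = n"
    and sch: "par_u sch = u" "par_v sch = v" "par_w sch = w"
  defines "share \<equiv> fst (schemeI_encode cm sch A B) ! i"
  shows "dim_row (fst share) = t div u" "dim_col (fst share) = r div n div w"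
    "dim_row (snd share) = r div n div w" "dim_col (snd share) = s div v"
  using assms
  by (simp_all add: schemeI_encode_def batch_encode_def split_beta fst_ep_encode_nth pack_def
      fst_mat_costed mats_def)

lemma length_schemeI_encode: "length (fst (schemeI_encode cm sch A B)) = length (points sch)"
  by (simp add: schemeI_encode_def batch_encode_def split_beta length_fst_ep_encode)

context
  fixes sch :: "('a, 'b) scheme" and R :: "'a ring" and A B :: "'a mat"
    and t r s n u v w N :: nat and cm :: cost_model
  assumes A: "A \<in> mats R t r" and B: "B \<in> mats R r s" and N: "length (points sch) = N"
    and n: "batch sch = n" and par: "par_u sch = u" "par_v sch = v" "par_w sch = w"
begin

lemma schemeI_upload_eq:
  "schemeI_upload cm sch A B
    = N * ((t div u) * (r div n div w) + (r div n div w) * (s div v)) * ext_deg sch"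
proof -
  let ?shares = "fst (schemeI_encode cm sch A B)"
  have "(case ?shares ! i of (X, Y) \<Rightarrow> mat_size (ext_deg sch) X + mat_size (ext_deg sch) Y)
      = ((t div u) * (r div n div w) + (r div n div w) * (s div v)) * ext_deg sch" if "i < N" for i
    using schemeI_share_dims[OF _ A B n par, of i cm] that N
    by (simp add: mat_size_def split_beta add_mult_distrib)
  then show ?thesis
    unfolding schemeI_upload_def sum_list_sum_nth by (simp add: length_schemeI_encode N)
qed

lemma schemeI_download_eq:
  assumes "responders N k ws"
  shows "schemeI_download cm sch A B ws = k * ((t div u) * (s div v) * ext_deg sch)"
proof -
  have "mat_size (ext_deg sch) (fst (schemeI_response cm sch A B i)) = (t div u) * (s div v) * ext_deg sch"
    if "i \<in> set ws" for i
    using schemeI_share_dims[OF _ A B n par, of i cm] that assms N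
    by (auto simp: responders_def schemeI_response_def worker_def mat_size_def split_beta mmult_def)
  then have "map (\<lambda>i. mat_size (ext_deg sch) (fst (schemeI_response cm sch A B i))) ws
      = map (\<lambda>i. (t div u) * (s div v) * ext_deg sch) ws"
    by simp
  then show ?thesis
    using assms by (simp only: schemeI_download_def sum_list_triv map_replicate_const responders_def
        sum_list_replicate of_nat_id)
qed

lemma schemeI_response_cost:
  assumes "i < N"
  shows "snd (schemeI_response cm sch A B i)
    = matmul_ops cm (t div u) (r div n div w) (s div v) * ring_ops cm (ext_deg sch)"
  using schemeI_share_dims[OF _ A B n par, of i cm] assms N
  by (simp add: schemeI_response_def worker_def split_beta)

end

text \<open>Only the number of responses matters. The summands are interpolation, evaluation of
  \<psi> and the final summation over the batch.\<close>

lemma schemeI_decode_cost: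
  assumes "batch sch = n" "par_u sch = u" "par_v sch = v" "length resp = k"
  shows "snd (schemeI_decode cm sch t s resp)
    = (t div u) * (s div v) * (interp_ops cm k * ring_ops cm (ext_deg sch)) +
      t * s * psi_ops sch + t * s * (n - 1)"
  using assms
  by (simp add: schemeI_decode_def batch_decode_def ep_decode_def split_beta Let_def
      snd_mat_costed_const interpolate_def)

lemma lg_ge_1: "1 \<le> lg x" and lglg_ge_1: "1 \<le> lglg x"
  by (auto simp: lg_def lglg_def)

lemma lglg_le_lg:
  assumes "1 \<le> x"
  shows "lglg x \<le> lg x"
\<comment> \<open>At 1 the inner logarithm is 0, where the outer one takes a default value;
  elsewhere \<open>ln y <= y - 1\<close> applies with \<open>y = ln x\<close>.\<close>
proof (cases "x = 1")
  case False
  then have "0 < ln x"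
    using assms by simp
  then have "ln (ln x) \<le> ln x"
    using ln_le_minus_one[of "ln x"] by linarith
  then show ?thesis
    unfolding lg_def lglg_def by (intro max.mono) auto
qed (simp add: lg_def lglg_def)

lemma lglg_mono:
  assumes "1 \<le> x" "x \<le> y"
  shows "lglg x \<le> lglg y"
proof (cases "x = 1")
  case False
  then have "ln (ln x) \<le> ln (ln y)"
    using assms by simp
  then show ?thesis
    by (simp add: lglg_def)
qed (simp add: lglg_def)

lemma extension_degree_pos:
  fixes p d N m :: nat
  assumes "2 \<le> p" "1 \<le> d" "2 \<le> N" "m = nat \<lceil>log p N / d\<rceil>"
  shows "1 \<le> m"
proof -
  have "0 < log p N / d"
    using assms by simp
  then show ?thesis
    using assms(4) by linarith
qed

text \<open>This is what the choice of \<open>m\<close> secures: \<open>d * m\<close> is at least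
  the base-\<open>p\<close> logarithm of \<open>N\<close>, so each worker can receive its own
  point.\<close>

lemma workers_le_exceptional:
  fixes p d N m :: nat
  assumes "2 \<le> p" "1 \<le> d" "2 \<le> N" "m = nat \<lceil>log p N / d\<rceil>"
  shows "N \<le> p ^ (d * m)"
proof -
  have "log p N / d \<le> m"
    using assms(4) by linarith
  then have "log p N \<le> real (d * m)"
    using assms(2) by (simp add: field_simps)
  then have "real N \<le> real p powr real (d * m)"
    using assms(1,3) by (simp add: log_le_iff)
  then show ?thesis
    using assms(1) by (simp only: powr_realpow of_nat_le_iff flip: of_nat_power)
qed

text \<open>As \<open>p\<close> and \<open>d\<close> only shrink it, \<open>m\<close> is at most
  \<open>1 + 2 ln N\<close>, hence at most three times \<open>max 1 (ln N)\<close>; one more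
  logarithm gives the bound.\<close>

lemma lg_extension_degree_le:
  fixes p d N m :: nat
  assumes "2 \<le> p" "1 \<le> d" "2 \<le> N" "m = nat \<lceil>log p N / d\<rceil>"
  shows "lg m \<le> 3 * lglg N"
proof -
  define L where "L = max 1 (ln (real N))"
  have "log p N / d \<le> log p N"
    using assms(1-3) by (simp add: divide_le_eq)
  also have "\<dots> \<le> log 2 N"
    using assms(1,3) by (simp add: log_def frac_le)
  also have "\<dots> \<le> 2 * ln N"
  proof -
    \<comment> \<open>The inequality \<open>ln x <= x - 1\<close> at \<open>x = 1/2\<close>.\<close>
    have "1 / 2 \<le> ln (2::real)"
      using ln_le_minus_one[of "1 / 2 :: real"] by (simp add: ln_div)
    then show ?thesis
      using assms(3) by (simp add: log_def field_simps)
  qed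
  finally have "log p N / d \<le> 2 * ln N" .
  moreover have "0 \<le> log p N / d"
    using assms(1,3) by simp
  ultimately have "m \<le> 1 + 2 * ln N"
    using assms(4) by linarith
  then have "real m \<le> 3 * L"
    by (auto simp: L_def)
  then have "ln m \<le> ln (3 * L)"
    using extension_degree_pos[OF assms] by simp
  also have "\<dots> = ln 3 + ln L"
    by (simp add: L_def ln_mult)
  \<comment> \<open>Either \<open>L = 1\<close> and \<open>ln L = 0\<close>, or
    \<open>ln L = ln (ln N)\<close>; and \<open>ln 3\<close> is at most 2.\<close>
  also have "\<dots> \<le> 2 + lglg N"
  proof -
    have "ln L \<le> lglg N"
      by (auto simp: L_def lglg_def max_def)
    then show ?thesis
      using ln_le_minus_one[of "3::real"] by simp
  qed
  also have "\<dots> \<le> 3 * lglg N"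
    using lglg_ge_1[of N] by simp
  finally show ?thesis
    using lglg_ge_1[of N] by (simp add: lg_def)
qed

text \<open>Each of the three logarithmic factors is at most \<open>3 * lglg N\<close>, whence 27
  and the cube.\<close>

lemma quasilinear_extension_degree_le:
  fixes p d N m :: nat
  assumes "2 \<le> p" "1 \<le> d" "2 \<le> N" "m = nat \<lceil>log p N / d\<rceil>"
  shows "quasilinear m \<le> 27 * real m * lglg N ^ 3"
proof -
  have le: "lg m \<le> 3 * lglg N" "lglg m \<le> 3 * lglg N"
    using lg_extension_degree_le[OF assms] lglg_le_lg[of "real m"] extension_degree_pos[OF assms] by auto
  then have "(lg m)\<^sup>2 * lglg m \<le> (3 * lglg N)\<^sup>2 * (3 * lglg N)"
    using lg_ge_1[of m] lglg_ge_1[of m] by (intro mult_mono power_mono) auto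
  then have "real m * ((lg m)\<^sup>2 * lglg m) \<le> real m * ((3 * lglg N)\<^sup>2 * (3 * lglg N))"
    by (intro mult_left_mono) auto
  then show ?thesis
    by (simp add: quasilinear_def power2_eq_square power3_eq_cube mult_ac)
qed

text \<open>Only the iterated logarithm is raised to its value at \<open>N\<close>, to be absorbed
  by the soft O; \<open>lg k\<close> stays, since the decoding bound is in terms of
  \<open>R\<close>.\<close>

lemma quasilinear_le:
  assumes "1 \<le> k" "k \<le> N"
  shows "quasilinear k \<le> real k * (lg k)\<^sup>2 * lglg N"
  using lglg_mono[of "real k" "real N"] assms unfolding quasilinear_def by (intro mult_left_mono) auto

text \<open>The quantifier order expresses uniformity: \<open>C\<close> and \<kappa> are chosen
  before the sizes, the extension, the RMFE and the points. Powers of \<open>lglg N\<close> realise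
  the soft O. The claim \<open>N <= card T\<close> guarantees that lists of points as described
  exist.\<close>

theorem corollary4p1:
  fixes p e d :: nat and f :: "nat \<Rightarrow> int" and K c1 c2 :: real and cm :: cost_model
  assumes "Factorial_Ring.prime p" and "e \<ge> 1" and "d \<ge> 1"
    and "galois_poly p e d f"
    and "admissible K cm"
    and "0 < c1" and "0 < c2"
    and GR: "GR = galois_ring p e f"
  shows "\<exists>(C::real) (\<kappa>::nat). 0 < C \<and>
    (\<forall>(N::nat) (m::nat) (n::nat) (t::nat) (r::nat) (s::nat) (u::nat) (v::nat) (w::nat) (R::nat)
       F GRm emb \<phi> \<psi> c\<^sub>\<phi> c\<^sub>\<psi> T A B.
      2 \<le> N \<and>
      m = nat \<lceil>log (real p) (real N) / real d\<rceil> \<and>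
      c1 * real m \<le> real n \<and> real n \<le> c2 * real m \<and>
      0 < n \<and> n dvd r \<and>
      0 < u \<and> u dvd t \<and> 0 < v \<and> v dvd s \<and> 0 < w \<and> w dvd r div n \<and>
      R = u * v * w + w - 1 \<and> R \<le> N \<and>
      A \<in> mats GR t r \<and> B \<in> mats GR r s \<and>
      galois_poly p e (d * m) F \<and> GRm = galois_ring p e F \<and> emb \<in> Ring.ring_hom GR GRm \<and>
      rmfe GR GRm emb n \<phi> \<psi> \<and>
      real c\<^sub>\<phi> \<le> K * quasilinear m \<and> real c\<^sub>\<psi> \<le> K * quasilinear m \<and>
      exceptional GRm T \<and> card T = p ^ (d * m)
      \<longrightarrow>
      N \<le> card T \<and>
      (\<forall>\<alpha>s. length \<alpha>s = N \<and> distinct \<alpha>s \<and> set \<alpha>s \<subseteq> T \<longrightarrow>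
        (let sch = \<lparr>base_ring = GR, ext_ring = GRm, ext_deg = m, batch = n,
                    rmfe_phi = \<phi>, rmfe_psi = \<psi>, phi_ops = c\<^sub>\<phi>, psi_ops = c\<^sub>\<psi>,
                    points = \<alpha>s, par_u = u, par_v = v, par_w = w\<rparr>;
             response = (\<lambda>i. fst (schemeI_response cm sch A B i));
             X = (real t * real r * real v + real s * real r * real u) / (real u * real v * real w);
             Y = real t * real s / (real u * real v);
             Z = real t * real s * real r / (real u * real v * real w)
         in
           recovery_threshold N R response (\<lambda>resp. fst (schemeI_decode cm sch t s resp)) (mmult GR A B) \<and>
           real (schemeI_upload cm sch A B) \<le> C * (X * real N) \<and>
           (\<forall>ws. responders N R ws \<longrightarrow>
              real (schemeI_download cm sch A B ws) \<le> C * (Y * real m * real R)) \<and>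
           real (snd (schemeI_encode cm sch A B))
             \<le> C * (X * real N * (lg (real N))\<^sup>2) * lglg (real N) ^ \<kappa> \<and>
           (\<forall>ws. responders N R ws \<longrightarrow>
              real (snd (schemeI_decode cm sch t s (collect response ws)))
                \<le> C * (Y * real m * real R * (lg (real R))\<^sup>2) * lglg (real N) ^ \<kappa>) \<and>
           (\<forall>i<N. real (snd (schemeI_response cm sch A B i))
                \<le> C * Z * lglg (real N) ^ \<kappa>))))"
proof -

  \<comment> \<open>Cost bounds and the choice of the uniform constants\<close>
  have prime: "2 \<le> p"
    using assms(1) by (simp add: prime_ge_2_nat)
  have admissible: "1 \<le> k \<Longrightarrow> real (ring_ops cm k) \<le> K * quasilinear k"
    "1 \<le> k \<Longrightarrow> real (eval_ops cm k) \<le> K * quasilinear k"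
    "1 \<le> k \<Longrightarrow> real (interp_ops cm k) \<le> K * quasilinear k"
    "real (matmul_ops cm a b c) \<le> K * (real a * real b * real c)" for k a b c
    using assms(5) by (auto simp: admissible_def)
  have K: "0 \<le> K"
  proof -
    \<comment> \<open>A cost is a natural number, and \<open>quasilinear 1\<close> is positive, so
      the sign of \<open>K\<close> can be read off.\<close>
    have "0 \<le> K * quasilinear 1"
      using admissible(1)[of 1] by (meson le_refl of_nat_0_le_iff order_trans)
    then show ?thesis
      by (simp add: quasilinear_def lg_def lglg_def)
  qed
  \<comment> \<open>Large enough for all five bounds: the factor \<open>1 / c1\<close> arises
    wherever \<open>m / n\<close> is estimated, and \<open>c2\<close> from adding up the
    \<open>n\<close> block products.\<close>
  define C where "C = (1 + 1 / c1) * (27 * K\<^sup>2 + 27 * K + 1) + c2"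
  have C: "0 < C" "1 \<le> C" "1 / c1 \<le> C" "27 * K / c1 + 27 * K\<^sup>2 / c1 \<le> C"
    "27 * K\<^sup>2 + 27 * K + c2 \<le> C" "27 * K\<^sup>2 / c1 \<le> C"
    using K assms(6,7) by (auto simp: C_def algebra_simps add_divide_distrib add_pos_nonneg add_nonneg_nonneg)
  show ?thesis
  \<comment> \<open>The exponent 4 consists of 3 for one operation in the extension ring and 1 for
    polynomial evaluation or interpolation.\<close>
  proof (intro exI[of _ C] exI[of _ 4] conjI C(1) allI impI; (elim conjE)?)

    \<comment> \<open>Enough evaluation points for the workers\<close>
    fix N m n t r s u v w R :: nat and F GRm emb \<phi> \<psi> c\<^sub>\<phi> c\<^sub>\<psi> T A B
    assume N: "2 \<le> N" and m: "m = nat \<lceil>log (real p) (real N) / real d\<rceil>"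
    assume "card T = p ^ (d * m)"
    then show "N \<le> card T"
      using workers_le_exceptional[OF prime assms(3) N m] by simp
  next

    \<comment> \<open>Notation and the basic estimates for \<open>m\<close>, \<open>n\<close> and
      \<open>R\<close>\<close>
    fix N m n t r s u v w R :: nat and F GRm emb \<phi> \<psi> c\<^sub>\<phi> c\<^sub>\<psi> T A B \<alpha>s
    assume N: "2 \<le> N" and m: "m = nat \<lceil>log (real p) (real N) / real d\<rceil>"
      and n: "c1 * real m \<le> real n" "real n \<le> c2 * real m" "0 < n" "n dvd r"
      and uvw: "0 < u" "u dvd t" "0 < v" "v dvd s" "0 < w" "w dvd r div n"
      and R: "R = u * v * w + w - 1" "R \<le> N"
      and A: "A \<in> mats GR t r" and B: "B \<in> mats GR r s"
      and F: "galois_poly p e (d * m) F" "GRm = galois_ring p e F"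
      and rmfe: "rmfe GR GRm emb n \<phi> \<psi>"
      and ops: "real c\<^sub>\<phi> \<le> K * quasilinear m" "real c\<^sub>\<psi> \<le> K * quasilinear m"
      and T: "exceptional GRm T"
      and \<alpha>s: "length \<alpha>s = N" "distinct \<alpha>s" "set \<alpha>s \<subseteq> T"
    define sch where "sch = \<lparr>base_ring = GR, ext_ring = GRm, ext_deg = m, batch = n,
                    rmfe_phi = \<phi>, rmfe_psi = \<psi>, phi_ops = c\<^sub>\<phi>, psi_ops = c\<^sub>\<psi>,
                    points = \<alpha>s, par_u = u, par_v = v, par_w = w\<rparr>"
    have sch: "base_ring sch = GR" "ext_ring sch = GRm" "ext_deg sch = m" "batch sch = n"
      "rmfe_phi sch = \<phi>" "rmfe_psi sch = \<psi>" "phi_ops sch = c\<^sub>\<phi>" "psi_ops sch = c\<^sub>\<psi>"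
      "points sch = \<alpha>s" "par_u sch = u" "par_v sch = v" "par_w sch = w"
      by (simp_all add: sch_def)
    have cring: "cring GR" "cring GRm"
      using cring_galois_ring[OF assms(1,2)] assms(4) GR F by auto
    have pts: "exceptional GRm (set (points sch))" "distinct (points sch)"
      using T \<alpha>s(2,3) unfolding exceptional_def sch by blast+
    define \<Lambda> where "\<Lambda> = lglg (real N)"
    define X where "X = (real t * real r * real v + real s * real r * real u) / (real u * real v * real w)"
    define Y where "Y = real t * real s / (real u * real v)"
    define Z where "Z = real t * real s * real r / (real u * real v * real w)"
    have \<Lambda>: "1 \<le> \<Lambda>"
      by (simp add: \<Lambda>_def lglg_ge_1)
    have XYZ: "0 \<le> X" "0 \<le> Y" "0 \<le> Z"
      by (simp_all add: X_def Y_def Z_def)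
    have m1: "1 \<le> m"
      using extension_degree_pos[OF prime assms(3) N m] .
    \<comment> \<open>The gain from packing: the factor \<open>m\<close> for the size or arithmetic
      of the extension is offset by the \<open>n\<close> products handled at once.\<close>
    have mn: "real m / real n \<le> 1 / c1"
      using n(1,3) assms(6) by (simp add: field_simps)
    have R1: "1 \<le> R" "u * v * w \<le> R"
    proof -
      have "1 \<le> u * v * w"
        using uvw by (simp add: Suc_le_eq)
      then show "1 \<le> R" "u * v * w \<le> R"
        using R(1) uvw(5) by linarith+
    qed
    have qm: "quasilinear m \<le> 27 * real m * \<Lambda> ^ 3"
      using quasilinear_extension_degree_le[OF prime assms(3) N m] by (simp add: \<Lambda>_def)
    have Kqm: "K * quasilinear m \<le> 27 * K * real m * \<Lambda> ^ 3"
      using mult_left_mono[OF qm K] by (simp add: mult_ac)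
    have ring_m: "real (ring_ops cm m) \<le> 27 * K * real m * \<Lambda> ^ 3"
      using admissible(1)[OF m1] Kqm by linarith
    have dims: "real (t div u) = real t / real u" "real (s div v) = real s / real v"
      "real (r div n) = real r / real n" "real (r div n div w) = real r / real n / real w"
      using uvw n(4) by (simp_all add: real_of_nat_div)
    \<comment> \<open>The number of extension ring elements sent to one worker.\<close>
    have shares: "real ((t div u) * (r div n div w) + (r div n div w) * (s div v)) = X / real n"
      using uvw n(3) unfolding of_nat_add of_nat_mult dims X_def by (simp add: field_simps)

    \<comment> \<open>Recovery of the product from any \<open>R\<close> responses\<close>
    have "recovery_threshold N R (\<lambda>i. fst (schemeI_response cm sch A B i))
        (\<lambda>resp. fst (schemeI_decode cm sch t s resp)) (mmult GR A B)"
      using schemeI_recovery[OF cring sch(1,2,4,10-12) _ uvw(1,3,5) n(3) uvw(2) n(4) uvw(6,4) A B pts]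
        rmfe \<alpha>s(1) R(1) by (simp add: sch)

    \<comment> \<open>Communication: upload and download\<close>
    moreover have "real (schemeI_upload cm sch A B) \<le> C * (X * real N)"
    proof -
      have "real (schemeI_upload cm sch A B) = real N * (X / real n) * real m"
        unfolding schemeI_upload_eq[OF A B _ sch(4,10-12), unfolded sch, OF \<alpha>s(1)]
        by (simp only: of_nat_mult shares)
      also have "\<dots> = (real m / real n) * (X * real N)"
        by simp
      also have "\<dots> \<le> C * (X * real N)"
        using mn C(3) XYZ by (intro mult_right_mono) auto
      finally show ?thesis .
    qed
    moreover have "real (schemeI_download cm sch A B ws) \<le> C * (Y * real m * real R)"
      if "responders N R ws" for ws
    proof -
      have "real (schemeI_download cm sch A B ws) = 1 * (Y * real m * real R)"
        unfolding schemeI_download_eq[OF A B _ sch(4,10-12), unfolded sch, OF \<alpha>s(1) that]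
        by (simp add: dims Y_def)
      also have "\<dots> \<le> C * (Y * real m * real R)"
        using C(2) XYZ by (intro mult_right_mono) auto
      finally show ?thesis .
    qed

    \<comment> \<open>Encoding cost: packing plus evaluation at \<open>N\<close> points\<close>
    moreover have "real (snd (schemeI_encode cm sch A B))
        \<le> C * (X * real N * (lg (real N))\<^sup>2) * \<Lambda> ^ 4"
    proof -
      have lg: "1 \<le> (lg (real N))\<^sup>2"
        using lg_ge_1 by (simp add: one_le_power)
      have "real (t * (r div n) + (r div n) * s) * real c\<^sub>\<phi>
          \<le> (X * real N / real n) * (27 * K * real m * \<Lambda> ^ 3)"
      proof (rule mult_mono)
        have "u * w \<le> u * v * w" "v * w \<le> u * v * w"
          using uvw by auto
        then have "u * w \<le> N" "v * w \<le> N"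
          using R1(2) R(2) by linarith+
        then have uw: "real u * real w \<le> real N" "real v * real w \<le> real N"
          by (metis of_nat_le_iff of_nat_mult)+
        \<comment> \<open>Packing visits every entry of both inputs, while \<open>X\<close> is
          smaller by the factors \<open>u * w\<close> and \<open>v * w\<close>; both are at most
          \<open>N\<close>.\<close>
        have "real t * real r + real r * real s \<le> X * real N"
        proof -
          have "X = real t * real r / (real u * real w) + real r * real s / (real v * real w)"
            using uvw by (simp add: X_def field_simps)
          moreover have "real t * real r \<le> real t * real r / (real u * real w) * real N"
            using uvw mult_left_mono[OF uw(1), of "real t * real r"] by (simp add: field_simps)
          moreover have "real r * real s \<le> real r * real s / (real v * real w) * real N"
            using uvw mult_left_mono[OF uw(2), of "real r * real s"] by (simp add: field_simps)
          ultimately show ?thesis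
            by (simp add: distrib_right)
        qed
        then have "(real t * real r + real r * real s) / real n \<le> X * real N / real n"
          by (intro divide_right_mono) auto
        then show "real (t * (r div n) + (r div n) * s) \<le> X * real N / real n"
          by (simp add: dims add_divide_distrib)
      qed (use ops(1) Kqm XYZ in auto)
      also have "\<dots> = (27 * K * (real m / real n)) * (X * real N * (1 * \<Lambda> ^ 3))"
        by simp
      \<comment> \<open>Packing needs neither the squared logarithm nor the fourth power; inserting
        them, both at least 1, gives it the same shape as the evaluation cost.\<close>
      also have "\<dots> \<le> (27 * K / c1) * (X * real N * ((lg (real N))\<^sup>2 * \<Lambda> ^ 4))"
        using mult_left_mono[OF mn, of "27 * K"] K XYZ lg \<Lambda> power_increasing[of 3 4 \<Lambda>] assms(6)
        by (intro mult_mono mult_left_mono) auto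
      finally have phi: "real (t * (r div n) + (r div n) * s) * real c\<^sub>\<phi>
        \<le> (27 * K / c1) * (X * real N * ((lg (real N))\<^sup>2 * \<Lambda> ^ 4))" .
      \<comment> \<open>One factor \<Lambda> from the evaluation algorithm and three from the
        arithmetic of the extension.\<close>
      have "real (eval_ops cm N) * real (ring_ops cm m)
          \<le> (K * (real N * (lg (real N))\<^sup>2 * \<Lambda>)) * (27 * K * real m * \<Lambda> ^ 3)"
        using admissible(2)[of N] quasilinear_le[of N N] mult_left_mono[OF _ K] N ring_m K \<Lambda>
        by (intro mult_mono) (auto simp: \<Lambda>_def intro: order_trans)
      then have "X / real n * (real (eval_ops cm N) * real (ring_ops cm m))
          \<le> X / real n * ((K * (real N * (lg (real N))\<^sup>2 * \<Lambda>)) * (27 * K * real m * \<Lambda> ^ 3))"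
        using XYZ by (intro mult_left_mono) auto
      also have "\<dots> = (27 * K\<^sup>2 * (real m / real n)) * (X * real N * ((lg (real N))\<^sup>2 * \<Lambda> ^ 4))"
        by (simp add: power2_eq_square power3_eq_cube power4_eq_xxxx)
      also have "\<dots> \<le> (27 * K\<^sup>2 / c1) * (X * real N * ((lg (real N))\<^sup>2 * \<Lambda> ^ 4))"
        using mult_left_mono[OF mn, of "27 * K\<^sup>2"] XYZ lg \<Lambda> by (intro mult_right_mono) auto
      finally have ep: "X / real n * (real (eval_ops cm N) * real (ring_ops cm m))
        \<le> (27 * K\<^sup>2 / c1) * (X * real N * ((lg (real N))\<^sup>2 * \<Lambda> ^ 4))" .
      have "snd (schemeI_encode cm sch A B) = (t * (r div n) + (r div n) * s) * c\<^sub>\<phi> +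
          ((t div u) * (r div n div w) + (r div n div w) * (s div v)) * (eval_ops cm N * ring_ops cm m)"
        using schemeI_encode_cost[OF cring(2) sch(2,4,10-12) _ uvw(1,3,5) n(3) uvw(2) n(4) uvw(6,4) A B]
          rmfe R \<alpha>s(1) by (simp only: sch)
      then have "real (snd (schemeI_encode cm sch A B)) = real (t * (r div n) + (r div n) * s) * real c\<^sub>\<phi> +
          X / real n * (real (eval_ops cm N) * real (ring_ops cm m))"
        by (simp only: of_nat_add[of "_ * c\<^sub>\<phi>"] of_nat_mult[of _ "c\<^sub>\<phi>"] of_nat_mult[of _ "_ * ring_ops cm m"]
            of_nat_mult[of _ "ring_ops cm m"] shares)
      also have "\<dots> \<le> (27 * K / c1 + 27 * K\<^sup>2 / c1) * (X * real N * ((lg (real N))\<^sup>2 * \<Lambda> ^ 4))"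
        unfolding distrib_right[of "27 * K / c1"] by (rule add_mono[OF phi ep])
      also have "\<dots> \<le> C * (X * real N * ((lg (real N))\<^sup>2 * \<Lambda> ^ 4))"
        using C(4) XYZ \<Lambda> by (intro mult_right_mono) auto
      finally show ?thesis
        by (simp add: mult_ac)
    qed

    \<comment> \<open>Decoding cost: interpolation, unpacking and summation\<close>
    moreover have "real (snd (schemeI_decode cm sch t s (collect response ws)))
        \<le> C * (Y * real m * real R * (lg (real R))\<^sup>2) * \<Lambda> ^ 4"
      if "responders N R ws" for ws and response
    proof -
      let ?b = "Y * real m * real R * ((lg (real R))\<^sup>2 * \<Lambda> ^ 4)"
      have lg: "1 \<le> (lg (real R))\<^sup>2"
        using lg_ge_1 by (simp add: one_le_power)
      have "real (interp_ops cm R) * real (ring_ops cm m)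
          \<le> (K * (real R * (lg (real R))\<^sup>2 * \<Lambda>)) * (27 * K * real m * \<Lambda> ^ 3)"
        using admissible(3)[of R] quasilinear_le[of R N] mult_left_mono[OF _ K] R(2) R1(1) ring_m K \<Lambda>
        by (intro mult_mono) (auto simp: \<Lambda>_def intro: order_trans)
      then have "Y * (real (interp_ops cm R) * real (ring_ops cm m))
          \<le> Y * ((K * (real R * (lg (real R))\<^sup>2 * \<Lambda>)) * (27 * K * real m * \<Lambda> ^ 3))"
        using XYZ by (intro mult_left_mono) auto
      also have "\<dots> = 27 * K\<^sup>2 * ?b"
        by (simp add: power2_eq_square power3_eq_cube power4_eq_xxxx)
      finally have interp: "Y * (real (interp_ops cm R) * real (ring_ops cm m)) \<le> 27 * K\<^sup>2 * ?b" .
      have "u * v \<le> u * v * w"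
        using uvw by auto
      then have "u * v \<le> R"
        using R1(2) by linarith
      then have "real u * real v \<le> real R"
        by (metis of_nat_le_iff of_nat_mult)
      \<comment> \<open>Unpacking and summation touch all \<open>t * s\<close> entries of the
        product; the factor \<open>R\<close>, at least \<open>u * v\<close>, pays for this.\<close>
      then have ts: "real t * real s \<le> Y * real R"
        using uvw mult_left_mono[of "real u * real v" "real R" "real t * real s"] by (simp add: Y_def field_simps)
      have "real t * real s * real c\<^sub>\<psi> \<le> (Y * real R) * (27 * K * real m * \<Lambda> ^ 3)"
        using ops(2) Kqm XYZ by (intro mult_mono[OF ts]) auto
      also have "\<dots> = 27 * K * (Y * real m * real R * (1 * \<Lambda> ^ 3))"
        by simp
      also have "\<dots> \<le> 27 * K * ?b"
        using K XYZ lg \<Lambda> power_increasing[of 3 4 \<Lambda>] by (intro mult_left_mono mult_mono) auto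
      finally have psi: "real t * real s * real c\<^sub>\<psi> \<le> 27 * K * ?b" .
      \<comment> \<open>Here the upper bound \<open>n <= c2 * m\<close> enters.\<close>
      have "real t * real s * real (n - 1) \<le> (Y * real R) * (c2 * real m)"
        using n(2) XYZ by (intro mult_mono[OF ts]) auto
      also have "\<dots> = c2 * (Y * real m * real R * (1 * 1))"
        by simp
      also have "\<dots> \<le> c2 * ?b"
        using assms(7) XYZ lg \<Lambda> one_le_power[of \<Lambda> 4] by (intro mult_left_mono mult_mono) auto
      finally have sum: "real t * real s * real (n - 1) \<le> c2 * ?b" .
      have "length (collect response ws) = R"
        using that by (simp add: collect_def responders_def)
      then have "real (snd (schemeI_decode cm sch t s (collect response ws)))
          = Y * (real (interp_ops cm R) * real (ring_ops cm m)) + real t * real s * real c\<^sub>\<psi>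
            + real t * real s * real (n - 1)"
        by (simp add: schemeI_decode_cost[OF sch(4,10,11)] sch dims Y_def del: of_nat_diff)
      also have "\<dots> \<le> (27 * K\<^sup>2 + 27 * K + c2) * ?b"
        using interp psi sum unfolding distrib_right by linarith
      also have "\<dots> \<le> C * ?b"
        using C(5) XYZ \<Lambda> by (intro mult_right_mono) auto
      finally show ?thesis
        by (simp add: mult_ac)
    qed

    \<comment> \<open>Cost of one worker's matrix product over the extension\<close>
    moreover have "real (snd (schemeI_response cm sch A B i)) \<le> C * Z * \<Lambda> ^ 4" if "i < N" for i
    proof -
      have "real (snd (schemeI_response cm sch A B i))
          \<le> (K * (real (t div u) * real (r div n div w) * real (s div v))) * (27 * K * real m * \<Lambda> ^ 3)"
        unfolding schemeI_response_cost[OF A B _ sch(4,10-12), unfolded sch, OF \<alpha>s(1) that] of_nat_mult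
        using admissible(4) ring_m K by (intro mult_mono) auto
      \<comment> \<open>The inner dimension of a share carries the divisor \<open>n\<close> that is
        set against the \<open>m\<close> of the extension arithmetic.\<close>
      also have "\<dots> = (27 * K\<^sup>2 * (real m / real n)) * (Z * \<Lambda> ^ 3)"
        unfolding dims Z_def by (simp add: power2_eq_square mult_ac)
      also have "\<dots> \<le> (27 * K\<^sup>2 / c1) * (Z * \<Lambda> ^ 4)"
        using mult_left_mono[OF mn, of "27 * K\<^sup>2"] XYZ \<Lambda> power_increasing[of 3 4 \<Lambda>] assms(6)
        by (intro mult_mono mult_left_mono) auto
      also have "\<dots> \<le> C * (Z * \<Lambda> ^ 4)"
        using C(6) XYZ \<Lambda> by (intro mult_right_mono) auto
      finally show ?thesis
        by (simp add: mult_ac)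
    qed
    ultimately show "let sch = \<lparr>base_ring = GR, ext_ring = GRm, ext_deg = m, batch = n,
                    rmfe_phi = \<phi>, rmfe_psi = \<psi>, phi_ops = c\<^sub>\<phi>, psi_ops = c\<^sub>\<psi>,
                    points = \<alpha>s, par_u = u, par_v = v, par_w = w\<rparr>;
             response = (\<lambda>i. fst (schemeI_response cm sch A B i));
             X = (real t * real r * real v + real s * real r * real u) / (real u * real v * real w);
             Y = real t * real s / (real u * real v);
             Z = real t * real s * real r / (real u * real v * real w)
         in
           recovery_threshold N R response (\<lambda>resp. fst (schemeI_decode cm sch t s resp)) (mmult GR A B) \<and>
           real (schemeI_upload cm sch A B) \<le> C * (X * real N) \<and>
           (\<forall>ws. responders N R ws \<longrightarrow>
              real (schemeI_download cm sch A B ws) \<le> C * (Y * real m * real R)) \<and>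
           real (snd (schemeI_encode cm sch A B))
             \<le> C * (X * real N * (lg (real N))\<^sup>2) * lglg (real N) ^ 4 \<and>
           (\<forall>ws. responders N R ws \<longrightarrow>
              real (snd (schemeI_decode cm sch t s (collect response ws)))
                \<le> C * (Y * real m * real R * (lg (real R))\<^sup>2) * lglg (real N) ^ 4) \<and>
           (\<forall>i<N. real (snd (schemeI_response cm sch A B i))
                \<le> C * Z * lglg (real N) ^ 4)"
      unfolding Let_def X_def[symmetric] Y_def[symmetric] Z_def[symmetric] sch_def[symmetric] \<Lambda>_def[symmetric]
      by blast
  qed
qed

end
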